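(* Let $a$ and $b$ be two positive integers, and let $\lambda=(b,\ldots,b)$, where $b$ occurs $a$ times, i.e. the Young diagram of $\lambda$ is an $a\times b$ rectangle. Then $$E_\lambda=\frac{2ab}{a+b},$$ the harmonic mean of $a$ and $b$. Moreover, the number of edges in the graph $BN(\lambda)$ is $$\frac{ab}{a+b}\cdot(ab+1)!\prod_{j=0}^{b-1}\frac{j!}{(a+j)!}.$$
   Context: Let $n=ab$ be the number of boxes of $\lambda$; rows are numbered from the top. A standard Young tableau of shape $\lambda$ is a bijective filling of its boxes with $1,\ldots,n$ strictly increasing along rows and columns. An almost-standard Young tableau of shape $\lambda$ is an injective filling of its boxes with numbers from $\{1,\ldots,n+1\}$ strictly increasing along rows and columns. $BN(\lambda)$ is the graph whose vertices are the almost-standard Young tableaux of shape $\lambda$, two being adjacent iff they differ in exactly one box. A staircase path in $\lambda$ is a lattice path along box edges from the lower left to the upper right corner of the rectangle using only right-steps and up-steps. A turn is a consecutive pair of steps (right, up) or (up, right) such that both steps border a common box of $\lambda$. For a standard Young tableau $T$ and $m\in\{1,\ldots,n+1\}$, $s(T,m)$ is the unique staircase path dividing the entries $<m$ of $T$ from the entries $\ge m$. $E_\lambda$ is the expected number of turns of $s(T,m)$ when $T$ is chosen uniformly among standard Young tableaux of shape $\lambda$ and $m$ is chosen independently and uniformly in $\{1,\ldots,n+1\}$. *)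

theory Defs
  imports "HOL-Probability.Probability"
begin

(* A partition is the weakly decreasing list of its row lengths.  The box (i, j) lies in
   row i (counted from the top) and column j (counted from the left), both from 0. *)

definition boxes :: "nat list \<Rightarrow> (nat \<times> nat) set" where
  "boxes l = {(i, j). i < length l \<and> j < l ! i}"

abbreviation size_of :: "nat list \<Rightarrow> nat" where
  "size_of l \<equiv> card (boxes l)"

definition increasing_filling :: "nat list \<Rightarrow> (nat \<times> nat \<Rightarrow> nat) \<Rightarrow> bool" where
  "increasing_filling l T \<longleftrightarrow>
     (\<forall>i j j'. (i, j) \<in> boxes l \<longrightarrow> (i, j') \<in> boxes l \<longrightarrow> j < j' \<longrightarrow> T (i, j) < T (i, j')) \<and>
     (\<forall>i i' j. (i, j) \<in> boxes l \<longrightarrow> (i', j) \<in> boxes l \<longrightarrow> i < i' \<longrightarrow> T (i, j) < T (i', j))"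

(* The extensional function space makes a filling determined by its values on the boxes,
   so that cardinalities of sets of fillings are the intended ones. *)

definition SYT :: "nat list \<Rightarrow> (nat \<times> nat \<Rightarrow> nat) set" where
  "SYT l = {T \<in> boxes l \<rightarrow>\<^sub>E {1..size_of l}.
              bij_betw T (boxes l) {1..size_of l} \<and> increasing_filling l T}"

definition almost_SYT :: "nat list \<Rightarrow> (nat \<times> nat \<Rightarrow> nat) set" where
  "almost_SYT l = {T \<in> boxes l \<rightarrow>\<^sub>E {1..size_of l + 1}.
                     inj_on T (boxes l) \<and> increasing_filling l T}"

(* The simple graph with vertex set almost_SYT l; edges are two-element sets of vertices. *)

definition BN_edges :: "nat list \<Rightarrow> (nat \<times> nat \<Rightarrow> nat) set set" where
  "BN_edges l = {{S, T} | S T. S \<in> almost_SYT l \<and> T \<in> almost_SYT l \<and>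
                   card {x \<in> boxes l. S x \<noteq> T x} = 1}"

(* Lattice points are pairs (r, c), where r counts downwards and c counts to the right;
   the box (i, j) has the corners (i, j), (i, j + 1), (i + 1, j), (i + 1, j + 1).
   A lattice path is the list of lattice points it visits. *)

definition box_sides :: "nat \<times> nat \<Rightarrow> (nat \<times> nat) set set" where
  "box_sides x = (case x of (i, j) \<Rightarrow>
     {{(i, j), (i, j + 1)}, {(i + 1, j), (i + 1, j + 1)},
      {(i, j), (i + 1, j)}, {(i, j + 1), (i + 1, j + 1)}})"

definition right_step :: "nat \<times> nat \<Rightarrow> nat \<times> nat \<Rightarrow> bool" where
  "right_step u v \<longleftrightarrow> fst v = fst u \<and> snd v = snd u + 1"

definition up_step :: "nat \<times> nat \<Rightarrow> nat \<times> nat \<Rightarrow> bool" where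
  "up_step u v \<longleftrightarrow> fst u = fst v + 1 \<and> snd v = snd u"

definition staircase_path :: "nat list \<Rightarrow> (nat \<times> nat) list \<Rightarrow> bool" where
  "staircase_path l p \<longleftrightarrow>
     p \<noteq> [] \<and> hd p = (length l, 0) \<and> last p = (0, hd l) \<and>
     (\<forall>k. k + 1 < length p \<longrightarrow>
        (right_step (p ! k) (p ! (k + 1)) \<or> up_step (p ! k) (p ! (k + 1))) \<and>
        (\<exists>x \<in> boxes l. {p ! k, p ! (k + 1)} \<in> box_sides x))"

(* The turn at index k is made of the steps from p ! k to p ! (k + 1) and from there to
   p ! (k + 2). *)

definition is_turn :: "nat list \<Rightarrow> (nat \<times> nat) list \<Rightarrow> nat \<Rightarrow> bool" where
  "is_turn l p k \<longleftrightarrow> k + 2 < length p \<and>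
     (right_step (p ! k) (p ! (k + 1)) \<and> up_step (p ! (k + 1)) (p ! (k + 2)) \<or>
      up_step (p ! k) (p ! (k + 1)) \<and> right_step (p ! (k + 1)) (p ! (k + 2))) \<and>
     (\<exists>x \<in> boxes l. {p ! k, p ! (k + 1)} \<in> box_sides x \<and>
                     {p ! (k + 1), p ! (k + 2)} \<in> box_sides x)"

definition turns :: "nat list \<Rightarrow> (nat \<times> nat) list \<Rightarrow> nat" where
  "turns l p = card {k. is_turn l p k}"

(* A box is on the upper left side of a path if the path climbs through the row of the
   box at a column boundary to the right of the box. *)

definition upper_left :: "(nat \<times> nat) list \<Rightarrow> nat \<times> nat \<Rightarrow> bool" where
  "upper_left p x \<longleftrightarrow>
     (\<exists>k c. k + 1 < length p \<and> p ! k = (fst x + 1, c) \<and> p ! (k + 1) = (fst x, c) \<and> snd x < c)"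

definition dividing_path :: "nat list \<Rightarrow> (nat \<times> nat \<Rightarrow> nat) \<Rightarrow> nat \<Rightarrow> (nat \<times> nat) list" where
  "dividing_path l T m =
     (THE p. staircase_path l p \<and> (\<forall>x \<in> boxes l. T x < m \<longleftrightarrow> upper_left p x))"

definition expected_turns :: "nat list \<Rightarrow> real" where
  "expected_turns l =
     measure_pmf.expectation (pair_pmf (pmf_of_set (SYT l)) (pmf_of_set {1..size_of l + 1}))
       (\<lambda>(T, m). real (turns l (dividing_path l T m)))"

end

(*  Idea. Shifting the entries >= m up by one turns a pair (T, m) into an almost-standard tableau
    U together with the value v = m that U misses, and the turns of s(T, m) are the boxes that
    can be added to or removed from the order ideal {U < v}. Replacing the entry of such a box by
    v is an edge of BN, and it exchanges "addable" with "removable"; hence each box x is addable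
    for as many U, say A(x), as it is removable, the number of edges is the sum of all A(x), and
    the expected number of turns is twice that sum, divided by the number of U.

    For a single order ideal, the indicator of "(p+1,q+1) is addable" minus that of "(p,q) is
    removable" is a mixed difference of the indicator of the ideal. Summing over U and telescoping,
    all row sums of A are equal, all column sums are equal, and one row sum plus one column sum is
    the number N of all U, so (a + b) * (sum of A) = a * b * N.

    The number of standard tableaux comes from the formula n! det(1 / (x_i - j)!) for general
    shapes, which satisfies the recursion over removable boxes by the Leibniz expansion. *)

theory Submission
  imports Defs "Jordan_Normal_Form.Determinant"
begin

section \<open>Counting standard Young tableaux\<close>

text \<open>Up to factors depending only on the row or only on the column this is the determinant of
  the \<open>1 / (x i - j)!\<close>. It equals the Vandermonde product of the \<open>x i\<close>
  divided by the product of the factorials below \<open>r\<close>. With binomials the entries with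
  \<open>j > x i\<close> vanish by themselves.\<close>

definition binom_det :: "nat \<Rightarrow> (nat \<Rightarrow> nat) \<Rightarrow> real" where
  "binom_det r x = det (mat r r (\<lambda>(i, j). real (x i choose j)))"

lemma binom_det_expand:
  "binom_det r x =
     (\<Sum>p | p permutes {0..<r}. signof p * (\<Prod>i = 0..<r. real (x i choose p i)))"
proof -
  have "(\<Prod>i = 0..<r. mat r r (\<lambda>(i, j). real (x i choose j)) $$ (i, p i)) =
        (\<Prod>i = 0..<r. real (x i choose p i))" if "p permutes {0..<r}" for p
    using permutes_in_image[OF that] by (intro prod.cong) auto
  then show ?thesis
    unfolding binom_det_def by (subst det_def'[of _ r]) (auto intro!: sum.cong)
qed

lemma binom_det_cong: "(\<And>i. i < r \<Longrightarrow> x i = y i) \<Longrightarrow> binom_det r x = binom_det r y"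
  unfolding binom_det_expand by (intro sum.cong refl arg_cong2[of _ _ _ _ times] prod.cong) auto

text \<open>The subtraction on the right is real, so for \<open>k > n\<close> both sides vanish; for
  \<open>n = 0\<close> the truncated \<open>n - 1\<close> is masked by the factor
  \<open>n\<close>.\<close>

lemma binomial_absorb_lowered:
  "real n * real ((n - 1) choose k) = (real n - real k) * real (n choose k)"
proof (cases "k \<le> n")
  case True
  then show ?thesis
    using arg_cong[OF binomial_absorb_comp[of n k], of real] by (simp add: of_nat_diff)
next
  case False
  then show ?thesis by (simp add: binomial_eq_0)
qed

text \<open>The determinant side of the recursion over removable boxes. In the Leibniz term of
  \<open>p\<close>, lowering \<open>x i\<close> produces the factor \<open>x i - p i\<close> by
  absorption. Summed over \<open>i\<close>, these factors no longer depend on \<open>p\<close>,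
  since \<open>p\<close> only rearranges the indices.\<close>

lemma sum_lowered_binom_det:
  "(\<Sum>i<r. real (x i) * binom_det r (x(i := x i - 1))) =
   ((\<Sum>i<r. real (x i)) - (\<Sum>i<r. real i)) * binom_det r x"
proof -
  let ?P = "{p. p permutes {0..<r}}"
  let ?t = "\<lambda>p. signof p * (\<Prod>i = 0..<r. real (x i choose p i))"
  have row: "real (x i) * (\<Prod>k = 0..<r. real ((x(i := x i - 1)) k choose p k)) =
        (real (x i) - real (p i)) * (\<Prod>k = 0..<r. real (x k choose p k))"
    if "i < r" for i p
  proof -
    have "(\<Prod>k\<in>{0..<r} - {i}. real ((x(i := x i - 1)) k choose p k)) =
          (\<Prod>k\<in>{0..<r} - {i}. real (x k choose p k))"
      by (intro prod.cong) auto
    then show ?thesis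
      using that binomial_absorb_lowered[of "x i" "p i"]
      by (simp add: prod.remove[of _ i] mult.assoc[symmetric])
  qed
  have "(\<Sum>i<r. real (x i) * binom_det r (x(i := x i - 1))) =
        (\<Sum>i<r. \<Sum>p\<in>?P. (real (x i) - real (p i)) * ?t p)"
    unfolding binom_det_expand sum_distrib_left
  proof (intro sum.cong refl)
    fix i p assume "i \<in> {..<r}"
    then show "real (x i) * (signof p * (\<Prod>k = 0..<r. real ((x(i := x i - 1)) k choose p k))) =
        (real (x i) - real (p i)) * ?t p"
      using row[of i p] by (simp add: mult.left_commute)
  qed
  also have "\<dots> = (\<Sum>p\<in>?P. (\<Sum>i<r. real (x i) - real (p i)) * ?t p)"
    by (subst sum.swap) (simp add: sum_distrib_right)
  also have "\<dots> = (\<Sum>p\<in>?P. ((\<Sum>i<r. real (x i)) - (\<Sum>i<r. real i)) * ?t p)"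
  proof (intro sum.cong refl)
    fix p assume "p \<in> ?P"
    then have "p permutes {..<r}" by (simp add: atLeast0LessThan)
    from sum.permute[OF this, of real]
    have "(\<Sum>i<r. real (p i)) = (\<Sum>i<r. real i)" by (simp add: o_def)
    then show "(\<Sum>i<r. real (x i) - real (p i)) * ?t p =
        ((\<Sum>i<r. real (x i)) - (\<Sum>i<r. real i)) * ?t p"
      by (simp add: sum_subtractf)
  qed
  also have "\<dots> = ((\<Sum>i<r. real (x i)) - (\<Sum>i<r. real i)) * binom_det r x"
    unfolding binom_det_expand by (simp add: sum_distrib_left)
  finally show ?thesis .
qed

lemma binom_det_eq_0:
  assumes "i < r" "j < r" "i \<noteq> j" "x i = x j"
  shows "binom_det r x = 0"
  unfolding binom_det_def
  by (rule det_identical_rows[of _ r i j]) (use assms in \<open>auto intro!: eq_vecI\<close>)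

lemma binom_det_id: "binom_det r (\<lambda>i. i) = 1"
  unfolding binom_det_def
  by (subst det_lower_triangular[of r]) (auto simp: prod_list_diag_prod)

text \<open>By Pascal's rule, raising all \<open>x i\<close> by one multiplies the matrix from the
  right by the upper unitriangular \<open>?U\<close>, whose determinant is one.\<close>

lemma binom_det_Suc: "binom_det r (\<lambda>i. Suc (x i)) = binom_det r x"
proof -
  let ?M = "mat r r (\<lambda>(i, j). real (x i choose j))"
  let ?U = "mat r r (\<lambda>(l, j). if l = j \<or> Suc l = j then 1 else 0) :: real mat"
  have pascal: "(\<Sum>l = 0..<r. real (n choose l) * (if l = j \<or> Suc l = j then 1 else 0)) =
        real (Suc n choose j)" if "j < r" for n j
  proof (cases j)
    case 0
    then have "(\<Sum>l = 0..<r. real (n choose l) * (if l = j \<or> Suc l = j then 1 else 0)) =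
               (\<Sum>l\<in>{0}. real (n choose l))"
      using that by (intro sum.mono_neutral_cong_right) auto
    then show ?thesis using 0 by simp
  next
    case (Suc k)
    then have "(\<Sum>l = 0..<r. real (n choose l) * (if l = j \<or> Suc l = j then 1 else 0)) =
               (\<Sum>l\<in>{k, Suc k}. real (n choose l))"
      using that by (intro sum.mono_neutral_cong_right) auto
    then show ?thesis using Suc by simp
  qed
  have "mat r r (\<lambda>(i, j). real (Suc (x i) choose j)) = ?M * ?U"
    by (rule eq_matI) (auto simp: scalar_prod_def pascal simp del: mult_cancel_left1)
  moreover have "det (?M * ?U) = det ?M * det ?U" by (rule det_mult) auto
  moreover have "det ?U = 1"
    by (subst det_upper_triangular[of _ r]) (auto simp: prod_list_diag_prod)
  ultimately show ?thesis by (simp add: binom_det_def)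
qed

lemma binom_det_rectangle: "binom_det r (\<lambda>i. b + i) = 1"
  by (induction b) (simp_all add: binom_det_id binom_det_Suc)

section \<open>Linear extensions, maximal boxes and diagrams given by row lengths\<close>

definition before :: "nat \<times> nat \<Rightarrow> nat \<times> nat \<Rightarrow> bool" where
  "before x y \<longleftrightarrow> fst x = fst y \<and> snd x < snd y \<or> snd x = snd y \<and> fst x < fst y"

lemma before_irrefl [simp]: "\<not> before x x"
  by (simp add: before_def)

definition increasing_on :: "(nat \<times> nat) set \<Rightarrow> (nat \<times> nat \<Rightarrow> nat) \<Rightarrow> bool" where
  "increasing_on S T \<longleftrightarrow> (\<forall>x\<in>S. \<forall>y\<in>S. before x y \<longrightarrow> T x < T y)"

lemma increasing_filling_iff: "increasing_filling l T \<longleftrightarrow> increasing_on (boxes l) T"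
proof
  assume "increasing_filling l T"
  then show "increasing_on (boxes l) T"
    unfolding increasing_filling_def increasing_on_def before_def
    by (metis prod.collapse)
next
  assume T: "increasing_on (boxes l) T"
  have "T (i, j) < T (i, j')" if "(i, j) \<in> boxes l" "(i, j') \<in> boxes l" "j < j'" for i j j'
    using T that by (auto simp: increasing_on_def before_def)
  moreover have "T (i, j) < T (i', j)" if "(i, j) \<in> boxes l" "(i', j) \<in> boxes l" "i < i'" for i i' j
    using T that by (auto simp: increasing_on_def before_def)
  ultimately show "increasing_filling l T" unfolding increasing_filling_def by blast
qed

definition linear_extensions :: "(nat \<times> nat) set \<Rightarrow> (nat \<times> nat \<Rightarrow> nat) set" where
  "linear_extensions S =
     {T \<in> S \<rightarrow>\<^sub>E {1..card S}. bij_betw T S {1..card S} \<and> increasing_on S T}"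

lemma SYT_eq: "SYT l = linear_extensions (boxes l)"
  by (simp add: SYT_def linear_extensions_def increasing_filling_iff)

lemma finite_linear_extensions: "finite S \<Longrightarrow> finite (linear_extensions S)"
  unfolding linear_extensions_def
  by (rule finite_subset[of _ "S \<rightarrow>\<^sub>E {1..card S}"]) (auto intro: finite_PiE)

lemma linear_extensions_outside:
  assumes "T \<in> linear_extensions S" "x \<notin> S"
  shows "T x = undefined"
  by (rule PiE_arb[of T S "\<lambda>_. {1..card S}"]) (use assms in \<open>simp_all add: linear_extensions_def\<close>)

definition maximal_boxes :: "(nat \<times> nat) set \<Rightarrow> (nat \<times> nat) set" where
  "maximal_boxes S = {x \<in> S. \<forall>y\<in>S. \<not> before x y}"

text \<open>The largest value \<open>card S\<close> must stand on a box with nothing after it.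
  Erasing it leaves a linear extension of the remaining boxes, and conversely it can be put on any
  maximal box.\<close>

lemma linear_extensions_split:
  assumes "finite S" "S \<noteq> {}"
  shows "linear_extensions S =
    (\<Union>x\<in>maximal_boxes S. (\<lambda>T. T(x := card S)) ` linear_extensions (S - {x}))"
proof (intro equalityI subsetI)
  fix T assume "T \<in> linear_extensions S"
  then have T: "T \<in> extensional S" "bij_betw T S {1..card S}" "increasing_on S T"
    by (auto simp: linear_extensions_def PiE_def)
  have pos: "card S > 0" using assms by (simp add: card_gt_0_iff)
  have "card S \<in> T ` S" using T(2) pos by (auto simp: bij_betw_def)
  then obtain x where x: "x \<in> S" "T x = card S" by auto
  have le: "T y \<le> card S" if "y \<in> S" for y
    using T(2) that by (auto simp: bij_betw_def)
  have max: "x \<in> maximal_boxes S"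
    using x T(3) le by (fastforce simp: maximal_boxes_def increasing_on_def)
  \<comment> \<open>Extensionality on \<open>S - {x}\<close> demands the value
    \<open>undefined\<close> at the deleted box.\<close>
  let ?T = "T(x := undefined)"
  have c: "card (S - {x}) = card S - 1" using x assms by simp
  have im: "T ` (S - {x}) = {1..card S} - {card S}"
    using T(2) x inj_on_image_set_diff[of T S S "{x}"] by (simp add: bij_betw_def)
  have im': "{1..card S} - {card S} = {1..card S - 1}" by auto
  have bij: "bij_betw T (S - {x}) {1..card (S - {x})}"
    unfolding bij_betw_def c im im'
    using T(2) by (auto simp: bij_betw_def intro: inj_on_subset)
  then have "bij_betw ?T (S - {x}) {1..card (S - {x})}"
    by (rule bij_betw_cong[THEN iffD1, rotated]) auto
  moreover have "?T \<in> extensional (S - {x})" using T(1) by (simp add: extensional_def)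
  moreover have "increasing_on (S - {x}) ?T"
    using T(3) by (auto simp: increasing_on_def)
  ultimately have "?T \<in> linear_extensions (S - {x})"
    by (simp only: linear_extensions_def PiE_def mem_Collect_eq Int_iff bij_betw_imp_funcset simp_thms)
  moreover have "T = ?T(x := card S)" by (simp add: x(2)[symmetric])
  ultimately show "T \<in> (\<Union>x\<in>maximal_boxes S. (\<lambda>T. T(x := card S)) ` linear_extensions (S - {x}))"
    by (intro UN_I[OF max] image_eqI)
next
  fix T assume "T \<in> (\<Union>x\<in>maximal_boxes S. (\<lambda>T. T(x := card S)) ` linear_extensions (S - {x}))"
  then obtain x U where x: "x \<in> maximal_boxes S" and U: "U \<in> linear_extensions (S - {x})"
    and T: "T = U(x := card S)" by blast
  have xS: "x \<in> S" "\<And>y. y \<in> S \<Longrightarrow> \<not> before x y" using x by (auto simp: maximal_boxes_def)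
  have pos: "card S > 0" using assms by (simp add: card_gt_0_iff)
  have c: "card (S - {x}) = card S - 1" using xS assms by simp
  have U': "U \<in> extensional (S - {x})" "bij_betw U (S - {x}) {1..card S - 1}"
    "increasing_on (S - {x}) U"
    using U unfolding linear_extensions_def c PiE_def by auto
  have ran: "T y < card S" if "y \<in> S - {x}" for y
  proof -
    have "U y \<in> {1..card S - 1}" using U'(2) that by (auto simp: bij_betw_def)
    then show ?thesis using T that by auto
  qed
  have "bij_betw T (S - {x}) {1..card S - 1}"
    using U'(2) by (rule bij_betw_cong[THEN iffD1, rotated]) (auto simp: T)
  then have "bij_betw T (insert x (S - {x})) (insert (T x) {1..card S - 1})"
    using pos notIn_Un_bij_betw[of x "S - {x}" T "{1..card S - 1}"] by (simp add: T)
  moreover have "insert x (S - {x}) = S" using xS by auto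
  moreover have "insert (T x) {1..card S - 1} = {1..card S}" using pos by (auto simp: T)
  ultimately have bij: "bij_betw T S {1..card S}" by metis
  moreover have "T \<in> extensional S" using U'(1) xS by (simp add: extensional_def T)
  moreover have "increasing_on S T"
    unfolding increasing_on_def
  proof (intro ballI impI)
    fix y z assume yz: "y \<in> S" "z \<in> S" "before y z"
    then have "y \<noteq> x" using xS(2)[OF yz(2)] by blast
    show "T y < T z"
    proof (cases "z = x")
      case True
      then show ?thesis using ran[of y] yz \<open>y \<noteq> x\<close> by (auto simp: T)
    next
      case False
      then show ?thesis using U'(3) yz \<open>y \<noteq> x\<close> by (auto simp: T increasing_on_def)
    qed
  qed
  ultimately show "T \<in> linear_extensions S"
    by (simp only: linear_extensions_def PiE_def mem_Collect_eq Int_iff bij_betw_imp_funcset simp_thms)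
qed

text \<open>The pieces of the splitting are disjoint, because injectivity lets only one box carry
  \<open>card S\<close>. Each update map is injective, because the overwritten value was
  \<open>undefined\<close> anyway.\<close>

lemma card_linear_extensions_rec:
  assumes "finite S" "S \<noteq> {}"
  shows "card (linear_extensions S) =
    (\<Sum>x\<in>maximal_boxes S. card (linear_extensions (S - {x})))"
proof -
  let ?F = "\<lambda>x. (\<lambda>T. T(x := card S)) ` linear_extensions (S - {x})"
  have fin: "finite (maximal_boxes S)" using assms by (auto simp: maximal_boxes_def)
  have sub: "?F x \<subseteq> linear_extensions S" if "x \<in> maximal_boxes S" for x
    using that linear_extensions_split[OF assms] by auto
  have disj: "?F x \<inter> ?F y = {}" if xy: "x \<in> maximal_boxes S" "y \<in> maximal_boxes S" "x \<noteq> y" for x y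
  proof (rule equals0I)
    fix T assume T: "T \<in> ?F x \<inter> ?F y"
    then have "inj_on T S" using sub[OF xy(1)]
      by (auto simp: linear_extensions_def bij_betw_def)
    moreover have "T z = card S" if "T \<in> ?F z" for z
      using that by (elim imageE) simp
    then have "T x = T y" using T by simp
    ultimately show False using xy by (auto simp: maximal_boxes_def inj_on_def)
  qed
  have "card (linear_extensions S) = (\<Sum>x\<in>maximal_boxes S. card (?F x))"
    unfolding linear_extensions_split[OF assms]
  proof (rule card_UN_disjoint[OF fin])
    show "\<forall>x\<in>maximal_boxes S. finite (?F x)"
      using assms by (simp add: finite_linear_extensions)
    show "\<forall>x\<in>maximal_boxes S. \<forall>y\<in>maximal_boxes S. x \<noteq> y \<longrightarrow> ?F x \<inter> ?F y = {}"
      using disj by blast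
  qed
  also have "\<dots> = (\<Sum>x\<in>maximal_boxes S. card (linear_extensions (S - {x})))"
  proof (intro sum.cong refl card_image inj_onI)
    fix x T U assume TU: "T \<in> linear_extensions (S - {x})" "U \<in> linear_extensions (S - {x})"
      and eq: "T(x := card S) = U(x := card S)"
    have "T x = undefined" "U x = undefined"
      using TU by (simp_all add: linear_extensions_outside)
    then have "T = (T(x := card S))(x := undefined)" "U = (U(x := card S))(x := undefined)"
      by (simp_all add: fun_upd_idem)
    then show "T = U" using eq by simp
  qed
  finally show ?thesis .
qed

(* The function h counts rows from the bottom: for a partition h is nondecreasing, so that
   the shifted row lengths h k + k increase strictly. *)
definition diagram :: "nat \<Rightarrow> (nat \<Rightarrow> nat) \<Rightarrow> (nat \<times> nat) set" where
  "diagram a h = {(i, j). i < a \<and> j < h (a - Suc i)}"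

lemma diagram_eq_Sigma: "diagram a h = (SIGMA i:{..<a}. {..<h (a - Suc i)})"
  by (auto simp: diagram_def)

lemma finite_diagram [simp]: "finite (diagram a h)"
  by (simp add: diagram_eq_Sigma)

lemma card_diagram: "card (diagram a h) = (\<Sum>k<a. h k)"
  by (simp add: diagram_eq_Sigma sum.nat_diff_reindex[of h a])

lemma boxes_replicate: "boxes (replicate a b) = {..<a} \<times> {..<b}"
  by (auto simp: boxes_def)

lemma boxes_replicate_diagram: "boxes (replicate a b) = diagram a (\<lambda>_. b)"
  by (auto simp: boxes_def diagram_def)

lemma diagram_remove_corner:
  assumes "k < a" "h k > 0"
  shows "diagram a h - {(a - Suc k, h k - 1)} = diagram a (h(k := h k - 1))"
proof -
  have "a - Suc i = k \<longleftrightarrow> i = a - Suc k" if "i < a" for i using that assms by auto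
  then show ?thesis using assms by (auto simp: diagram_def split: if_splits)
qed

text \<open>The rows whose last box can be removed. Comparing with every row below, not only with
  the next one, describes the maximal boxes for arbitrary \<open>h\<close>.\<close>

definition corner_rows :: "nat \<Rightarrow> (nat \<Rightarrow> nat) \<Rightarrow> nat set" where
  "corner_rows a h = {k. k < a \<and> h k > 0 \<and> (\<forall>j<k. h j < h k)}"

lemma maximal_boxes_diagram:
  "maximal_boxes (diagram a h) = (\<lambda>k. (a - Suc k, h k - 1)) ` corner_rows a h"
proof (intro equalityI subsetI)
  fix x assume x: "x \<in> maximal_boxes (diagram a h)"
  obtain i j where ij: "x = (i, j)" by force
  define k where "k = a - Suc i"
  have i: "i < a" "j < h k" using x by (auto simp: ij k_def maximal_boxes_def diagram_def)
  have k: "k < a" "i = a - Suc k" using i by (auto simp: k_def)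
  have nb: "\<not> before (i, j) y" if "y \<in> diagram a h" for y
    using x that by (auto simp: maximal_boxes_def ij)
  have "j = h k - 1"
  proof (rule ccontr)
    assume "j \<noteq> h k - 1"
    then have "(i, Suc j) \<in> diagram a h" using i by (auto simp: diagram_def k_def)
    from nb[OF this] show False by (simp add: before_def)
  qed
  moreover have "h l < h k" if "l < k" for l
  proof (rule ccontr)
    assume "\<not> h l < h k"
    moreover have "a - Suc (a - Suc l) = l" using that k by auto
    ultimately have "(a - Suc l, j) \<in> diagram a h" using i that k by (auto simp: diagram_def)
    from nb[OF this] show False using that k by (auto simp: before_def)
  qed
  ultimately show "x \<in> (\<lambda>k. (a - Suc k, h k - 1)) ` corner_rows a h"
    using k i by (auto simp: ij corner_rows_def)
next
  fix x assume "x \<in> (\<lambda>k. (a - Suc k, h k - 1)) ` corner_rows a h"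
  then obtain k where x: "x = (a - Suc k, h k - 1)" and k: "k < a" "h k > 0" "\<And>j. j < k \<Longrightarrow> h j < h k"
    by (auto simp: corner_rows_def)
  have "a - Suc (a - Suc k) = k" using k by auto
  then have "x \<in> diagram a h" using k by (auto simp: x diagram_def)
  moreover have "\<not> before x (i, j)" if "i < a" "j < h (a - Suc i)" for i j
  proof
    assume b: "before x (i, j)"
    show False
    proof (cases "i = a - Suc k")
      case True
      then have "a - Suc i = k" using k by auto
      then show False using b that True by (auto simp: before_def x)
    next
      case False
      then have "a - Suc i < k" "j = h k - 1" using b that k by (auto simp: before_def x)
      then show False using k(3)[of "a - Suc i"] that by auto
    qed
  qed
  ultimately show "x \<in> maximal_boxes (diagram a h)" by (auto simp: maximal_boxes_def diagram_def)
qed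

lemma card_linear_extensions_diagram_rec:
  assumes "(\<Sum>k<a. h k) > 0"
  shows "card (linear_extensions (diagram a h)) =
    (\<Sum>k\<in>corner_rows a h. card (linear_extensions (diagram a (h(k := h k - 1)))))"
proof -
  have "diagram a h \<noteq> {}" using assms card_diagram[of a h] by auto
  then have "card (linear_extensions (diagram a h)) =
    (\<Sum>x\<in>maximal_boxes (diagram a h). card (linear_extensions (diagram a h - {x})))"
    by (intro card_linear_extensions_rec) auto
  also have "\<dots> = (\<Sum>k\<in>corner_rows a h. card (linear_extensions (diagram a h - {(a - Suc k, h k - 1)})))"
    unfolding maximal_boxes_diagram
    by (subst sum.reindex) (auto simp: inj_on_def corner_rows_def)
  also have "\<dots> = (\<Sum>k\<in>corner_rows a h. card (linear_extensions (diagram a (h(k := h k - 1)))))"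
    by (intro sum.cong refl) (simp add: corner_rows_def diagram_remove_corner del: One_nat_def)
  finally show ?thesis .
qed

section \<open>The determinant formula and its rectangular case\<close>

lemma linear_extensions_empty: "linear_extensions {} = {\<lambda>_. undefined}"
  by (auto simp: linear_extensions_def increasing_on_def bij_betw_def)

text \<open>Induction on the number of boxes: the recursion over removable boxes is matched by
  \<open>sum_lowered_binom_det\<close>. That identity sums over all rows, but rows without a
  removable box contribute zero. Factorials are kept as multipliers, which avoids division.\<close>

lemma frobenius_formula:
  assumes "mono_on {..<a} h"
  shows "real (card (linear_extensions (diagram a h))) * (\<Prod>k<a. fact (h k + k)) =
    fact (\<Sum>k<a. h k) * (\<Prod>k<a. fact k) * binom_det a (\<lambda>k. h k + k)"
  using assms
proof (induction "\<Sum>k<a. h k" arbitrary: h)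
  case 0
  then have h: "h k = 0" if "k < a" for k using that by auto
  then have "diagram a h = {}" by (auto simp: diagram_def)
  moreover have "(\<Prod>k<a. fact (h k + k)) = (\<Prod>k<a. fact k :: real)"
    by (intro prod.cong) (auto simp: h)
  moreover have "binom_det a (\<lambda>k. h k + k) = 1"
    using binom_det_id[of a] binom_det_cong[of a "\<lambda>k. h k + k" "\<lambda>k. k"] h by simp
  ultimately show ?case using 0(1) by (simp add: linear_extensions_empty)
next
  case (Suc n)
  define x where "x = (\<lambda>k. h k + k)"
  let ?P = "(\<Prod>k<a. fact (x k)) :: real" and ?SF = "(\<Prod>k<a. fact k) :: real"
  let ?e = "\<lambda>h. real (card (linear_extensions (diagram a h)))"
  have mono: "h i \<le> h j" if "i \<le> j" "j < a" for i j
    using Suc.prems that by (auto simp: mono_on_def)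
  have corner: "?e (h(k := h k - 1)) * ?P =
      fact n * ?SF * (real (x k) * binom_det a (x(k := x k - 1)))"
    if k: "k \<in> corner_rows a h" for k
  proof -
    let ?h = "h(k := h k - 1)"
    have ka: "k < a" "h k > 0" "\<And>j. j < k \<Longrightarrow> h j < h k" using k by (auto simp: corner_rows_def)
    have "(\<Sum>j<a. h j) = h k + (\<Sum>j\<in>{..<a} - {k}. h j)"
      using ka by (intro sum.remove) auto
    moreover have "(\<Sum>j<a. ?h j) = ?h k + (\<Sum>j\<in>{..<a} - {k}. ?h j)"
      using ka by (intro sum.remove) auto
    moreover have "(\<Sum>j\<in>{..<a} - {k}. ?h j) = (\<Sum>j\<in>{..<a} - {k}. h j)"
      by (intro sum.cong) auto
    ultimately have n: "n = (\<Sum>j<a. ?h j)" using Suc.hyps(2) ka by simp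
    have "mono_on {..<a} ?h"
    proof (rule mono_onI)
      fix i j assume "i \<in> {..<a}" "j \<in> {..<a}" "i \<le> j"
      then show "?h i \<le> ?h j" using mono[of i j] ka(3)[of i] by (cases "i = j") auto
    qed
    from Suc.hyps(1)[OF n this] have IH: "?e ?h * (\<Prod>j<a. fact (?h j + j)) =
        fact n * ?SF * binom_det a (\<lambda>j. ?h j + j)"
      using n by simp
    have low: "(\<lambda>j. ?h j + j) = x(k := x k - 1)" using ka by (auto simp: x_def fun_eq_iff)
    have "?P = fact (x k) * (\<Prod>j\<in>{..<a} - {k}. fact (x j))"
      using ka by (intro prod.remove) auto
    also have "fact (x k) = real (x k) * fact (x k - 1)"
      using ka by (intro fact_reduce) (simp add: x_def)
    also have "(\<Prod>j\<in>{..<a} - {k}. fact (x j)) =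
        (\<Prod>j\<in>{..<a} - {k}. fact ((x(k := x k - 1)) j) :: real)"
      by (intro prod.cong) auto
    also have "real (x k) * fact (x k - 1) * \<dots> =
        real (x k) * (\<Prod>j<a. fact ((x(k := x k - 1)) j))"
      using ka by (subst prod.remove[of "{..<a}" k]) auto
    finally have P: "?P = real (x k) * (\<Prod>j<a. fact (?h j + j))" by (simp only: low fun_cong[OF low])
    show ?thesis using IH unfolding P low by (simp add: mult_ac)
  qed
  \<comment> \<open>If \<open>x k > 0\<close> but row \<open>k\<close> has no removable box, then
    row \<open>k - 1\<close> is equally long, and lowering \<open>x k\<close> makes it equal to
    \<open>x (k - 1)\<close>: two rows of the matrix coincide.\<close>
  have zero: "real (x k) * binom_det a (x(k := x k - 1)) = 0"
    if k: "k \<in> {..<a} - corner_rows a h" for k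
  proof (cases "x k = 0")
    case False
    have "\<exists>j<k. h j = h k"
    proof (cases "h k = 0")
      case True
      then show ?thesis using mono[of 0 k] k False by (intro exI[of _ 0]) (auto simp: x_def)
    next
      case False
      then obtain j where "j < k" "\<not> h j < h k" using k by (auto simp: corner_rows_def)
      then show ?thesis using mono[of j k] k by (intro exI[of _ j]) auto
    qed
    then obtain j where j: "j < k" "h j = h k" by blast
    have "h (k - 1) = h k" using mono[of j "k - 1"] mono[of "k - 1" k] j k by auto
    then have "(x(k := x k - 1)) k = (x(k := x k - 1)) (k - 1)" using j by (auto simp: x_def)
    then have "binom_det a (x(k := x k - 1)) = 0"
      using j k by (intro binom_det_eq_0[of k a "k - 1"]) auto
    then show ?thesis by simp
  qed simp
  have sub: "corner_rows a h \<subseteq> {..<a}" by (auto simp: corner_rows_def)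
  have "?e h * ?P = (\<Sum>k\<in>corner_rows a h. ?e (h(k := h k - 1)) * ?P)"
    using Suc.hyps(2) by (simp add: card_linear_extensions_diagram_rec sum_distrib_right)
  also have "\<dots> = fact n * ?SF * (\<Sum>k\<in>corner_rows a h. real (x k) * binom_det a (x(k := x k - 1)))"
    unfolding sum_distrib_left by (intro sum.cong refl corner)
  also have "(\<Sum>k\<in>corner_rows a h. real (x k) * binom_det a (x(k := x k - 1))) =
      (\<Sum>k<a. real (x k) * binom_det a (x(k := x k - 1)))"
    using zero sub by (intro sum.mono_neutral_left) auto
  also have "\<dots> = ((\<Sum>k<a. real (x k)) - (\<Sum>k<a. real k)) * binom_det a x"
    by (rule sum_lowered_binom_det)
  \<comment> \<open>The shifts by \<open>k\<close> cancel and leave the number of boxes, the factor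
    that turns \<open>fact n\<close> into \<open>fact (Suc n)\<close>.\<close>
  also have "(\<Sum>k<a. real (x k)) - (\<Sum>k<a. real k) = real (Suc n)"
    using Suc.hyps(2) by (simp add: x_def sum.distrib del: of_nat_Suc flip: of_nat_sum)
  finally show ?case using Suc.hyps(2)[symmetric] by (simp add: x_def mult_ac)
qed

lemma prod_fact_shift:
  "(\<Prod>k<b. fact k) * (\<Prod>k<a. fact (b + k)) = (\<Prod>k<a + b. fact k :: real)"
proof (induction a)
  case (Suc a)
  then show ?case by (simp add: mult.assoc[symmetric] add.commute)
qed simp

text \<open>For equal rows the determinant is one. The product of the factorials below
  \<open>a + b\<close> can be split after \<open>a\<close> or after \<open>b\<close> factors, which
  trades the product over the \<open>a\<close> rows for one over the \<open>b\<close>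
  columns.\<close>

lemma card_SYT_rectangle:
  "real (card (SYT (replicate a b))) = fact (a * b) * (\<Prod>j<b. fact j / fact (a + j))"
proof -
  let ?f = "real (card (SYT (replicate a b)))"
  let ?S = "\<lambda>n. \<Prod>k<n. fact k :: real"
  have nz: "(\<Prod>k<n. fact (m + k) :: real) \<noteq> 0" for n m by (simp add: prod_zero_iff)
  have "?f * (\<Prod>k<a. fact (b + k)) = fact (a * b) * ?S a"
    using frobenius_formula[of a "\<lambda>_. b"] binom_det_rectangle[of a b]
    by (simp add: SYT_eq boxes_replicate_diagram mono_on_def)
  then have "?f * (?S b * (\<Prod>k<a. fact (b + k))) = fact (a * b) * (?S a * ?S b)"
    by (simp add: mult_ac)
  also have "?S b * (\<Prod>k<a. fact (b + k)) = ?S a * (\<Prod>k<b. fact (a + k))"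
    using prod_fact_shift[of b a] prod_fact_shift[of a b] by (simp add: add.commute)
  finally have "?f * (\<Prod>k<b. fact (a + k)) = fact (a * b) * ?S b"
    using nz[of 0 a] by (simp add: mult_ac)
  then show ?thesis using nz[of a b] by (simp add: prod_dividef field_simps)
qed

section \<open>Almost-standard tableaux and the edges of BN\<close>

definition addable :: "(nat \<times> nat) set \<Rightarrow> (nat \<times> nat) set \<Rightarrow> nat \<times> nat \<Rightarrow> bool" where
  "addable S M x \<longleftrightarrow> x \<in> S \<and> x \<notin> M \<and> (\<forall>y\<in>S. before y x \<longrightarrow> y \<in> M)"

definition removable :: "(nat \<times> nat) set \<Rightarrow> (nat \<times> nat) set \<Rightarrow> nat \<times> nat \<Rightarrow> bool" where
  "removable S M x \<longleftrightarrow> x \<in> S \<and> x \<in> M \<and> (\<forall>y\<in>S. before x y \<longrightarrow> y \<notin> M)"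

(* Only one value is missed, so the second component is determined by the first. *)
definition gap_fillings :: "(nat \<times> nat) set \<Rightarrow> ((nat \<times> nat \<Rightarrow> nat) \<times> nat) set" where
  "gap_fillings S = {(U, v). U \<in> S \<rightarrow>\<^sub>E {1..card S + 1} \<and> inj_on U S \<and> increasing_on S U \<and>
     v \<in> {1..card S + 1} - U ` S}"

abbreviation below :: "(nat \<times> nat) set \<Rightarrow> (nat \<times> nat \<Rightarrow> nat) \<times> nat \<Rightarrow> (nat \<times> nat) set" where
  "below S q \<equiv> {x \<in> S. fst q x < snd q}"

text \<open>The move along an edge of the graph: the value freed at \<open>x\<close> becomes the new
  gap, so repeating the move undoes it.\<close>

definition swap_gap :: "nat \<times> nat \<Rightarrow> (nat \<times> nat \<Rightarrow> nat) \<times> nat \<Rightarrow> (nat \<times> nat \<Rightarrow> nat) \<times> nat" where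
  "swap_gap x q = ((fst q)(x := snd q), fst q x)"

lemma finite_gap_fillings: "finite S \<Longrightarrow> finite (gap_fillings S)"
  by (rule finite_subset[of _ "(S \<rightarrow>\<^sub>E {1..card S + 1}) \<times> {1..card S + 1}"])
     (auto simp: gap_fillings_def intro!: finite_PiE)

lemma swap_gap_swap_gap [simp]: "swap_gap x (swap_gap x q) = q"
  by (simp add: swap_gap_def prod_eq_iff)

lemma swap_gap_in_gap_fillings:
  assumes q: "q \<in> gap_fillings S" and x: "x \<in> S"
    and lo: "\<And>y. y \<in> S \<Longrightarrow> before y x \<Longrightarrow> fst q y < snd q"
    and hi: "\<And>y. y \<in> S \<Longrightarrow> before x y \<Longrightarrow> snd q < fst q y"
  shows "swap_gap x q \<in> gap_fillings S"
proof -
  obtain U v where qUv: "q = (U, v)" by force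
  have U: "U \<in> S \<rightarrow>\<^sub>E {1..card S + 1}" "inj_on U S" "increasing_on S U"
    and v: "v \<in> {1..card S + 1}" "v \<notin> U ` S"
    using q by (auto simp: qUv gap_fillings_def)
  have "U(x := v) \<in> S \<rightarrow>\<^sub>E {1..card S + 1}"
    using U(1) v(1) x by (auto simp: PiE_iff extensional_def)
  moreover have "inj_on (U(x := v)) S" using U(2) v(2) by (rule inj_on_fun_updI)
  moreover have "increasing_on S (U(x := v))"
    unfolding increasing_on_def
  proof (intro ballI impI)
    fix y z assume yz: "y \<in> S" "z \<in> S" "before y z"
    then have "y \<noteq> z" by auto
    then show "(U(x := v)) y < (U(x := v)) z"
      using yz U(3) lo[of y] hi[of z] by (auto simp: increasing_on_def qUv)
  qed
  moreover have "U x \<in> {1..card S + 1}" using U(1) x by (rule PiE_mem)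
  moreover have "U x \<notin> U(x := v) ` S"
    using U(2) v x by (auto simp: inj_on_def)
  ultimately show ?thesis by (simp add: qUv swap_gap_def gap_fillings_def)
qed

lemma gap_neq: "q \<in> gap_fillings S \<Longrightarrow> x \<in> S \<Longrightarrow> fst q x \<noteq> snd q"
  by (auto simp: gap_fillings_def)

lemma gap_increasing:
  "q \<in> gap_fillings S \<Longrightarrow> x \<in> S \<Longrightarrow> y \<in> S \<Longrightarrow> before x y \<Longrightarrow> fst q x < fst q y"
  by (auto simp: gap_fillings_def increasing_on_def)

text \<open>The entry of an addable box exceeds the gap while all entries before it are smaller than
  the gap, so it may drop to the gap value. The new gap is the old entry: now \<open>x\<close> lies
  below it and everything after \<open>x\<close> above it.\<close>

lemma swap_gap_addable:
  assumes q: "q \<in> gap_fillings S" and x: "addable S (below S q) x"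
  shows "swap_gap x q \<in> gap_fillings S" "removable S (below S (swap_gap x q)) x"
proof -
  have xS: "x \<in> S" and less: "snd q < fst q x"
    using x gap_neq[OF q, of x] by (auto simp: addable_def)
  show "swap_gap x q \<in> gap_fillings S"
    using x less gap_increasing[OF q xS]
    by (intro swap_gap_in_gap_fillings q) (auto simp: addable_def intro: less_trans)
  show "removable S (below S (swap_gap x q)) x"
    using xS less gap_increasing[OF q xS] by (fastforce simp: removable_def swap_gap_def)
qed

lemma swap_gap_removable:
  assumes q: "q \<in> gap_fillings S" and x: "removable S (below S q) x"
  shows "swap_gap x q \<in> gap_fillings S" "addable S (below S (swap_gap x q)) x"
proof -
  have xS: "x \<in> S" and less: "fst q x < snd q"
    using x by (auto simp: removable_def)
  have hi: "snd q < fst q y" if "y \<in> S" "before x y" for y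
    using x that gap_neq[OF q, of y] by (auto simp: removable_def)
  have lo: "fst q y < fst q x" if "y \<in> S" "before y x" for y
    using gap_increasing[OF q that(1) xS that(2)] .
  show "swap_gap x q \<in> gap_fillings S"
    using less lo hi xS
    by (intro swap_gap_in_gap_fillings q) (auto intro: less_trans)
  show "addable S (below S (swap_gap x q)) x"
    using xS less lo by (fastforce simp: addable_def swap_gap_def)
qed

text \<open>The involution \<open>swap_gap x\<close> exchanges the two sets. The symmetry holds for
  each box separately, but only after collecting all gap fillings.\<close>

lemma card_addable_eq_removable:
  "card {q \<in> gap_fillings S. addable S (below S q) x} =
   card {q \<in> gap_fillings S. removable S (below S q) x}"
  by (rule bij_betw_same_card[of "swap_gap x"], rule bij_betw_byWitness[where f' = "swap_gap x"])
     (auto simp: swap_gap_addable swap_gap_removable simp del: split_paired_All)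

lemma gap_unique:
  assumes "finite S" "(U, v) \<in> gap_fillings S" "(U, w) \<in> gap_fillings S"
  shows "v = w"
proof (rule ccontr)
  assume "v \<noteq> w"
  have U: "U ` S \<subseteq> {1..card S + 1} - {v, w}" "inj_on U S" "v \<in> {1..card S + 1}" "w \<in> {1..card S + 1}"
    using assms by (auto simp: gap_fillings_def PiE_iff)
  have "card S = card (U ` S)" using U(2) by (simp add: card_image)
  also have "\<dots> \<le> card ({1..card S + 1} - {v, w})" using U(1) by (intro card_mono) auto
  also have "\<dots> = card S + 1 - 2" using U(3,4) \<open>v \<noteq> w\<close> by (subst card_Diff_subset) auto
  \<comment> \<open>Because of truncated subtraction the empty set survives the count; there both
    values would lie in \<open>{1..1}\<close>.\<close>
  finally have "card S = 0" by linarith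
  then show False using U(3,4) \<open>v \<noteq> w\<close> by simp
qed

section \<open>Edges as moves at addable boxes\<close>

lemma almost_SYT_iff:
  "U \<in> almost_SYT l \<longleftrightarrow>
     U \<in> boxes l \<rightarrow>\<^sub>E {1..size_of l + 1} \<and> inj_on U (boxes l) \<and> increasing_on (boxes l) U"
  by (simp add: almost_SYT_def increasing_filling_iff)

lemma gap_fillings_boxes:
  "(U, v) \<in> gap_fillings (boxes l) \<longleftrightarrow>
     U \<in> almost_SYT l \<and> v \<in> {1..size_of l + 1} - U ` boxes l"
  by (simp add: gap_fillings_def almost_SYT_iff conj_assoc)

lemma finite_boxes: "finite (boxes l)"
proof -
  have "boxes l = (SIGMA i:{..<length l}. {..<l ! i})" by (auto simp: boxes_def)
  then show ?thesis by simp
qed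

text \<open>Every edge is oriented from the tableau with the larger entry in the box where the two
  differ. The smaller entry is then the gap of the first tableau, and the box is addable; the
  orientation makes each unordered edge arise exactly once.\<close>

lemma bij_betw_BN_edges:
  "bij_betw (\<lambda>(q, x). {fst q, fst (swap_gap x q)})
     {(q, x). q \<in> gap_fillings (boxes l) \<and> addable (boxes l) (below (boxes l) q) x} (BN_edges l)"
proof -
  let ?S = "boxes l"
  let ?A = "{(q, x). q \<in> gap_fillings ?S \<and> addable ?S (below ?S q) x}"
  let ?f = "\<lambda>(q, x). {fst q, fst (swap_gap x q)}"
  have up: "v < U x" "x \<in> ?S" if "((U, v), x) \<in> ?A" for U v x
    using that gap_neq[of "(U, v)" ?S x] by (auto simp: addable_def)
  have "inj_on ?f ?A"
  proof (rule inj_onI)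
    fix d e assume de: "d \<in> ?A" "e \<in> ?A" "?f d = ?f e"
    obtain U v x where d: "d = ((U, v), x)" by (metis prod.collapse)
    obtain W w y where e: "e = ((W, w), y)" by (metis prod.collapse)
    have x: "(U, v) \<in> gap_fillings ?S" "v < U x" and y: "(W, w) \<in> gap_fillings ?S" "w < W y"
      using up(1)[of U v x] up(1)[of W w y] de(1,2) by (simp_all add: d e)
    have "{U, U(x := v)} = {W, W(y := w)}"
      using de(3) by (simp add: swap_gap_def d e)
    then consider "U = W" "U(x := v) = W(y := w)" | "U = W(y := w)" "W = U(x := v)"
      by (auto simp: doubleton_eq_iff)
    then have "U = W \<and> v = w \<and> x = y"
    proof cases
      case 1
      then have "v = w" using gap_unique[OF finite_boxes] x y by blast
      moreover have "x = y"
      proof (rule ccontr)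
        assume "x \<noteq> y"
        then show False using fun_cong[OF 1(2), of x] 1(1) x by simp
      qed
      ultimately show ?thesis using 1 by simp
    next
      case 2
      \<comment> \<open>The two tableaux have traded roles. Both moves lower an entry, so each would
        undo the other, which is impossible.\<close>
      have "W x = v" "U y = w" using fun_cong[OF 2(2), of x] fun_cong[OF 2(1), of y] by simp_all
      then have False using x y fun_cong[OF 2(2), of y] by (auto split: if_splits)
      then show ?thesis ..
    qed
    then show "d = e" by (simp add: d e)
  qed
  moreover have "?f ` ?A \<subseteq> BN_edges l"
  proof
    fix e assume "e \<in> ?f ` ?A"
    then obtain U v x where a: "(U, v) \<in> gap_fillings ?S" "addable ?S (below ?S (U, v)) x"
      and e: "e = {U, U(x := v)}"
      by (auto simp: swap_gap_def)
    have x: "v < U x" "x \<in> ?S" using up[of U v x] a by auto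
    have "U \<in> almost_SYT l" "U(x := v) \<in> almost_SYT l"
      using a(1) swap_gap_addable(1)[OF a]
      by (simp_all add: gap_fillings_boxes swap_gap_def)
    moreover have "{y \<in> ?S. U y \<noteq> (U(x := v)) y} = {x}" using x by auto
    then have "card {y \<in> ?S. U y \<noteq> (U(x := v)) y} = 1" by simp
    ultimately show "e \<in> BN_edges l"
      unfolding BN_edges_def e by blast
  qed
  moreover have "BN_edges l \<subseteq> ?f ` ?A"
  proof
    fix e assume "e \<in> BN_edges l"
    then obtain V W where e: "e = {V, W}" and VW: "V \<in> almost_SYT l" "W \<in> almost_SYT l"
      and c: "card {x \<in> ?S. V x \<noteq> W x} = 1"
      unfolding BN_edges_def by blast
    from c obtain x where "{x \<in> ?S. V x \<noteq> W x} = {x}" by (rule card_1_singletonE)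
    then have xS: "x \<in> ?S" and diff: "V x \<noteq> W x" and only: "\<And>y. y \<in> ?S \<Longrightarrow> y \<noteq> x \<Longrightarrow> V y = W y"
      by blast+
    \<comment> \<open>\<open>B\<close> is the upper end of the oriented edge, and the value it
      misses is the entry of \<open>C\<close> at \<open>x\<close>.\<close>
    have edge: "{B, C} \<in> ?f ` ?A"
      if B: "B \<in> almost_SYT l" and C: "C \<in> almost_SYT l"
        and eq: "\<And>y. y \<in> ?S \<Longrightarrow> y \<noteq> x \<Longrightarrow> B y = C y" and less: "C x < B x" for B C
    proof -
      have same: "B y = C y" if "y \<noteq> x" for y
      proof (cases "y \<in> ?S")
        case True
        then show ?thesis using eq that by blast
      next
        case False
        then show ?thesis
          using B C PiE_arb[of B ?S "\<lambda>_. {1..size_of l + 1}" y]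
            PiE_arb[of C ?S "\<lambda>_. {1..size_of l + 1}" y]
          by (simp add: almost_SYT_iff)
      qed
      have "C x \<in> {1..size_of l + 1}"
        using C xS PiE_mem[of C ?S "\<lambda>_. {1..size_of l + 1}" x] by (simp add: almost_SYT_iff)
      moreover have "C x \<noteq> B y" if "y \<in> ?S" for y
      proof (cases "y = x")
        case False
        then have "C x \<noteq> C y" using C xS that unfolding almost_SYT_iff by (metis inj_onD)
        then show ?thesis using same[OF False] by simp
      qed (use less in simp)
      then have "C x \<notin> B ` ?S" by blast
      ultimately have "(B, C x) \<in> gap_fillings ?S"
        using B by (simp add: gap_fillings_boxes)
      moreover have "B y < C x" if "y \<in> ?S" "before y x" for y
      proof -
        have "C y < C x" using C that xS by (simp add: almost_SYT_iff increasing_on_def)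
        moreover have "y \<noteq> x" using that by auto
        ultimately show ?thesis using same[of y] by simp
      qed
      then have "addable ?S (below ?S (B, C x)) x" using xS less by (simp add: addable_def)
      ultimately have A: "((B, C x), x) \<in> ?A" by simp
      have "B(x := C x) = C" by (rule ext) (simp add: same)
      then have "{B, C} = ?f ((B, C x), x)" by (simp add: swap_gap_def)
      then show ?thesis using A by (rule image_eqI)
    qed
    consider "W x < V x" | "V x < W x" using diff by linarith
    then show "e \<in> ?f ` ?A"
    proof cases
      case 1
      then show ?thesis using edge[OF VW only] by (simp add: e)
    next
      case 2
      then show ?thesis using edge[OF VW(2,1) only[symmetric]] by (simp add: e insert_commute)
    qed
  qed
  ultimately show ?thesis by (simp add: bij_betw_def subset_antisym)
qed

lemma card_BN_edges:
  "card (BN_edges l) =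
     (\<Sum>x\<in>boxes l. card {q \<in> gap_fillings (boxes l). addable (boxes l) (below (boxes l) q) x})"
proof -
  let ?S = "boxes l"
  let ?A = "\<lambda>x. {q \<in> gap_fillings ?S. addable ?S (below ?S q) x}"
  have fin: "finite (?A x)" for x using finite_gap_fillings[OF finite_boxes] by simp
  have "card (BN_edges l) = card {(q, x). q \<in> gap_fillings ?S \<and> addable ?S (below ?S q) x}"
    using bij_betw_same_card[OF bij_betw_BN_edges] by simp
  also have "\<dots> = card (SIGMA x:?S. ?A x)"
    by (rule bij_betw_same_card[of prod.swap], rule bij_betw_byWitness[where f' = prod.swap])
       (auto simp: addable_def)
  also have "\<dots> = (\<Sum>x\<in>?S. card (?A x))"
    using fin finite_boxes by (simp add: card_SigmaI)
  finally show ?thesis .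
qed

section \<open>From standard tableaux with a chosen value to gap fillings\<close>

definition insert_gap :: "(nat \<times> nat) set \<Rightarrow> (nat \<times> nat \<Rightarrow> nat) \<times> nat \<Rightarrow> (nat \<times> nat \<Rightarrow> nat) \<times> nat" where
  "insert_gap S = (\<lambda>(T, m). (restrict (\<lambda>x. if T x < m then T x else T x + 1) S, m))"

text \<open>Only entries that are at least \<open>m\<close> get raised, so the ideal cut out by the
  gap is the one that \<open>s(T, m)\<close> separates from the rest.\<close>

lemma below_insert_gap: "below S (insert_gap S (T, m)) = {x \<in> S. T x < m}"
  by (auto simp: insert_gap_def)

text \<open>The inverse closes the gap by lowering every entry above the missing value.\<close>

lemma bij_betw_insert_gap:
  assumes "finite S"
  shows "bij_betw (insert_gap S) (linear_extensions S \<times> {1..card S + 1}) (gap_fillings S)"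
proof (rule bij_betw_byWitness[where f' = "\<lambda>(U, v). (restrict (\<lambda>x. if U x < v then U x else U x - 1) S, v)"])
  let ?g = "\<lambda>(U, v). (restrict (\<lambda>x. if U x < v then U x else U x - 1) S, v :: nat)"
  have ext: "T \<in> extensional S" if "T \<in> linear_extensions S" for T
    using that by (simp add: linear_extensions_def PiE_def)
  have extU: "U \<in> extensional S" if "(U, v) \<in> gap_fillings S" for U v
    using that by (simp add: gap_fillings_def PiE_def)
  show "\<forall>p\<in>linear_extensions S \<times> {1..card S + 1}. ?g (insert_gap S p) = p"
  proof clarify
    fix T m assume "T \<in> linear_extensions S" "m \<in> {1..card S + 1}"
    from ext[OF this(1)] show "?g (insert_gap S (T, m)) = (T, m)"
      by (auto simp: insert_gap_def fun_eq_iff restrict_def extensional_def)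
  qed
  show "\<forall>q\<in>gap_fillings S. insert_gap S (?g q) = q"
  proof
    fix d assume d: "d \<in> gap_fillings S"
    obtain U v where dUv: "d = (U, v)" by force
    have q: "(U, v) \<in> gap_fillings S" using d by (simp add: dUv)
    have neq: "U x \<noteq> v" if "x \<in> S" for x using gap_neq[OF q that] by simp
    let ?T = "restrict (\<lambda>x. if U x < v then U x else U x - 1) S"
    have "restrict (\<lambda>x. if ?T x < v then ?T x else ?T x + 1) S x = U x" for x
    proof (cases "x \<in> S")
      case True
      then show ?thesis using neq[OF True] by auto
    next
      case False
      then show ?thesis using extensional_arb[OF extU[OF q] False] by simp
    qed
    then show "insert_gap S (?g d) = d" by (simp add: dUv insert_gap_def fun_eq_iff)
  qed
  show "insert_gap S ` (linear_extensions S \<times> {1..card S + 1}) \<subseteq> gap_fillings S"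
  proof
    fix d assume "d \<in> insert_gap S ` (linear_extensions S \<times> {1..card S + 1})"
    then obtain T m where T: "T \<in> linear_extensions S" and m: "m \<in> {1..card S + 1}"
      and d: "d = insert_gap S (T, m)"
      by (elim imageE SigmaE) simp
    obtain U v where dUv: "d = (U, v)" by force
    have U: "U = restrict (\<lambda>x. if T x < m then T x else T x + 1) S" and v: "v = m"
      using d dUv by (simp_all add: insert_gap_def)
    have ran: "T x \<in> {1..card S}" if "x \<in> S" for x
      using T that by (auto simp: linear_extensions_def dest: PiE_mem)
    have inj: "inj_on T S" using T by (auto simp: linear_extensions_def bij_betw_def)
    have inc: "T x < T y" if "x \<in> S" "y \<in> S" "before x y" for x y
      using T that by (auto simp: linear_extensions_def increasing_on_def)
    have "U \<in> S \<rightarrow>\<^sub>E {1..card S + 1}"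
      unfolding U restrict_PiE_iff using ran by fastforce
    moreover have "inj_on U S"
      using inj by (auto simp: U inj_on_def split: if_splits)
    moreover have "increasing_on S U"
      using inc by (fastforce simp: U increasing_on_def)
    moreover have "m \<notin> U ` S" by (auto simp: U)
    ultimately show "d \<in> gap_fillings S" using m by (simp add: gap_fillings_def dUv v)
  qed
  show "?g ` gap_fillings S \<subseteq> linear_extensions S \<times> {1..card S + 1}"
  proof
    fix d assume "d \<in> ?g ` gap_fillings S"
    then obtain U v where q: "(U, v) \<in> gap_fillings S" and d: "d = ?g (U, v)"
      by (metis (no_types, lifting) imageE prod.collapse)
    define T where "T = restrict (\<lambda>x. if U x < v then U x else U x - 1) S"
    have v: "v \<in> {1..card S + 1}" using q by (simp add: gap_fillings_def)
    have ran: "U x \<in> {1..card S + 1}" if "x \<in> S" for x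
      using q that by (auto simp: gap_fillings_def dest: PiE_mem)
    have neq: "U x \<noteq> v" if "x \<in> S" for x using gap_neq[OF q that] by simp
    have inj: "inj_on U S" using q by (auto simp: gap_fillings_def)
    have inc: "U x < U y" if "x \<in> S" "y \<in> S" "before x y" for x y
      using gap_increasing[OF q that] by simp
    \<comment> \<open>An entry above \<open>v\<close> is at least \<open>2\<close> and one below
      \<open>v\<close> is at most \<open>card S\<close>, so closing the gap stays within the
      range.\<close>
    have val: "T x \<in> {1..card S}" if "x \<in> S" for x
      using ran[OF that] neq[OF that] v that by (auto simp: T_def)
    have eqT: "U x = U y" if "x \<in> S" "y \<in> S" "T x = T y" for x y
      using that neq[of x] neq[of y] by (auto simp: T_def split: if_splits)
    have injT: "inj_on T S"
      using inj eqT unfolding inj_on_def by blast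
    have "T ` S = {1..card S}"
      using val injT by (intro card_subset_eq) (auto simp: card_image)
    then have "bij_betw T S {1..card S}" using injT by (simp add: bij_betw_def)
    moreover have "T \<in> S \<rightarrow>\<^sub>E {1..card S}"
      using val by (simp add: PiE_iff T_def)
    moreover have "increasing_on S T"
      unfolding increasing_on_def
    proof (intro ballI impI)
      fix x y assume "x \<in> S" "y \<in> S" "before x y"
      then show "T x < T y" using inc[of x y] neq[of x] neq[of y] by (auto simp: T_def)
    qed
    ultimately have "T \<in> linear_extensions S" by (simp add: linear_extensions_def)
    then show "d \<in> linear_extensions S \<times> {1..card S + 1}" using v by (simp add: d T_def)
  qed
qed

section \<open>Addable and removable boxes of an ideal in a rectangle\<close>

text \<open>In the application \<open>A p q\<close> counts the fillings for which
  \<open>(p, q)\<close> is addable, and \<open>X p q\<close> those with \<open>(p, q)\<close> in the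
  ideal. Summed along a row, \<open>diag\<close> telescopes and shows that neighbouring rows have
  equal sums, with \<open>col\<close> supplying the term at the left edge. The last row telescopes
  by itself, since everything beneath it is zero.\<close>

lemma row_sum_of_corner_balance:
  fixes A X :: "nat \<Rightarrow> nat \<Rightarrow> real"
  assumes diag: "\<And>p q. A (Suc p) (Suc q) - A p q =
      X p (Suc q) + X (Suc p) q - X p q - X (Suc p) (Suc q)"
    and col: "\<And>p. Suc p < a \<Longrightarrow> A (Suc p) 0 = X p 0 - X (Suc p) 0"
    and zero: "\<And>p q. a \<le> p \<or> b \<le> q \<Longrightarrow> A p q = 0 \<and> X p q = 0"
    and p: "p < a"
  shows "(\<Sum>q<b. A p q) = X (a - 1) 0"
proof -
  have "p \<le> a - 1" using p by simp
  then show ?thesis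
  proof (induction rule: inc_induct)
    case base
    have "A (a - 1) q = X (a - 1) q - X (a - 1) (Suc q)" for q
      using diag[of "a - 1" q] zero[of a q] zero[of a "Suc q"] p by simp
    then show ?case
      using sum_lessThan_telescope'[of "X (a - 1)" b] zero[of "a - 1" b] by simp
  next
    case (step n)
    define D where "D = (\<lambda>q. X n q - X (Suc n) q)"
    have "(\<Sum>q<b. A (Suc n) (Suc q)) - (\<Sum>q<b. A n q) = (\<Sum>q<b. D (Suc q) - D q)"
      unfolding sum_subtractf[symmetric] by (intro sum.cong refl) (simp add: diag D_def)
    also have "\<dots> = D b - D 0" by (rule sum_lessThan_telescope)
    also have "\<dots> = - A (Suc n) 0"
      using zero[of n b] zero[of "Suc n" b] col[of n] step by (simp add: D_def)
    finally have "(\<Sum>q<b. A n q) = A (Suc n) 0 + (\<Sum>q<b. A (Suc n) (Suc q))" by simp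
    \<comment> \<open>The shifted sum reaches column \<open>b\<close>, where \<open>A\<close>
      vanishes, so this is the sum of the next row.\<close>
    also have "\<dots> = (\<Sum>q<Suc b. A (Suc n) q)" by (rule sum.lessThan_Suc_shift[symmetric])
    also have "\<dots> = X (a - 1) 0" using step zero[of "Suc n" b] by simp
    finally show ?case .
  qed
qed

text \<open>All row sums equal \<open>?R\<close> and, by transposition, all column sums equal
  \<open>?C\<close>. Telescoping the first column from the origin yields \<open>?R + ?C = N\<close>.
  The total is both \<open>a * ?R\<close> and \<open>b * ?C\<close>; weighting these two expressions
  by \<open>b\<close> and \<open>a\<close> gives the claim.\<close>

lemma sum_of_corner_balance:
  fixes A X :: "nat \<Rightarrow> nat \<Rightarrow> real"
  assumes diag: "\<And>p q. A (Suc p) (Suc q) - A p q =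
      X p (Suc q) + X (Suc p) q - X p q - X (Suc p) (Suc q)"
    and col: "\<And>p. Suc p < a \<Longrightarrow> A (Suc p) 0 = X p 0 - X (Suc p) 0"
    and row: "\<And>q. Suc q < b \<Longrightarrow> A 0 (Suc q) = X 0 q - X 0 (Suc q)"
    and origin: "A 0 0 = N - X 0 0"
    and zero: "\<And>p q. a \<le> p \<or> b \<le> q \<Longrightarrow> A p q = 0 \<and> X p q = 0"
    and pos: "a > 0" "b > 0"
  shows "(real a + real b) * (\<Sum>p<a. \<Sum>q<b. A p q) = real a * real b * N"
proof -
  let ?R = "X (a - 1) 0" and ?C = "X 0 (b - 1)"
  have rows: "(\<Sum>q<b. A p q) = ?R" if "p < a" for p
    using diag col zero that by (rule row_sum_of_corner_balance)
  have cols: "(\<Sum>p<a. A p q) = ?C" if "q < b" for q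
    by (rule row_sum_of_corner_balance[of "\<lambda>q p. A p q" "\<lambda>q p. X p q"])
       (use diag row zero that in \<open>auto simp: algebra_simps\<close>)
  have "?C = (\<Sum>p<a. A p 0)" using cols pos by simp
  also have "\<dots> = A 0 0 + (\<Sum>p<a - 1. A (Suc p) 0)"
    using sum.lessThan_Suc_shift[of "\<lambda>p. A p 0" "a - 1"] pos by simp
  also have "(\<Sum>p<a - 1. A (Suc p) 0) = (\<Sum>p<a - 1. X p 0 - X (Suc p) 0)"
    using col by (intro sum.cong) auto
  also have "\<dots> = X 0 0 - ?R" by (rule sum_lessThan_telescope')
  finally have RC: "?R + ?C = N" using origin by simp
  have "(\<Sum>p<a. \<Sum>q<b. A p q) = real a * ?R" using rows by simp
  moreover have "(\<Sum>p<a. \<Sum>q<b. A p q) = real b * ?C"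
    using cols by (subst sum.swap) simp
  ultimately show ?thesis using RC by (simp add: algebra_simps flip: RC)
qed

section \<open>Corners of a single order ideal\<close>

locale rectangle_ideal =
  fixes a b :: nat and M :: "(nat \<times> nat) set"
  assumes pos: "a > 0" "b > 0"
    and sub: "M \<subseteq> {..<a} \<times> {..<b}"
    and down: "\<And>i j i' j'. (i, j) \<in> M \<Longrightarrow> i' \<le> i \<Longrightarrow> j' \<le> j \<Longrightarrow> (i', j') \<in> M"
begin

abbreviation R :: "(nat \<times> nat) set" where "R \<equiv> {..<a} \<times> {..<b}"

lemma addable_iff:
  "addable R M (i, j) \<longleftrightarrow> i < a \<and> j < b \<and> (i, j) \<notin> M \<and>
     (i = 0 \<or> (i - 1, j) \<in> M) \<and> (j = 0 \<or> (i, j - 1) \<in> M)" (is "?L \<longleftrightarrow> ?r")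
proof
  assume L: ?L
  have "(i - 1, j) \<in> M" if "i \<noteq> 0"
    using L that by (auto simp: addable_def before_def)
  moreover have "(i, j - 1) \<in> M" if "j \<noteq> 0"
    using L that by (auto simp: addable_def before_def)
  ultimately show ?r using L by (auto simp: addable_def)
next
  assume r: ?r
  have "y \<in> M" if "y \<in> R" "before y (i, j)" for y
    using r that down[of "i - 1" j "fst y" "snd y"] down[of i "j - 1" "fst y" "snd y"]
    by (auto simp: before_def)
  then show ?L using r by (simp add: addable_def)
qed

lemma removable_iff:
  "removable R M (i, j) \<longleftrightarrow> (i, j) \<in> M \<and> (Suc i, j) \<notin> M \<and> (i, Suc j) \<notin> M" (is "?L \<longleftrightarrow> ?r")
proof
  assume L: ?L
  then show ?r using sub by (auto simp: removable_def before_def)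
next
  assume r: ?r
  have "y \<notin> M" if "before (i, j) y" for y
  proof
    assume "y \<in> M"
    then have "(Suc i, j) \<in> M \<or> (i, Suc j) \<in> M"
      using that down[of "fst y" "snd y" "Suc i" j] down[of "fst y" "snd y" i "Suc j"]
      by (auto simp: before_def)
    then show False using r by blast
  qed
  then show ?L using r sub by (auto simp: removable_def)
qed

text \<open>Consider the two by two square from \<open>(p, q)\<close> to
  \<open>(Suc p, Suc q)\<close>. The right side is \<open>1\<close> if \<open>M\<close> contains all
  of it but the last box, \<open>-1\<close> if \<open>M\<close> contains only the first box, and
  \<open>0\<close> in the other cases a down-closed set allows. Positions outside the rectangle
  count as not in \<open>M\<close>.\<close>

lemma corner_balance:
  "of_bool (addable R M (Suc p, Suc q)) - of_bool (removable R M (p, q)) =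
   (of_bool ((p, Suc q) \<in> M) + of_bool ((Suc p, q) \<in> M) - of_bool ((p, q) \<in> M) -
    of_bool ((Suc p, Suc q) \<in> M) :: real)"
proof -
  have "(Suc p, Suc q) \<in> M \<Longrightarrow> (p, Suc q) \<in> M" "(Suc p, Suc q) \<in> M \<Longrightarrow> (Suc p, q) \<in> M"
    "(p, Suc q) \<in> M \<Longrightarrow> (p, q) \<in> M" "(Suc p, q) \<in> M \<Longrightarrow> (p, q) \<in> M"
    by (auto elim: down)
  moreover have "(p, Suc q) \<in> M \<Longrightarrow> Suc q < b" "(Suc p, q) \<in> M \<Longrightarrow> Suc p < a"
    using sub by auto
  ultimately show ?thesis by (auto simp: addable_iff removable_iff of_bool_def)
qed

text \<open>The top row and the left column have no diagonal predecessor, so they need separate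
  relations: here one predecessor, or none, decides.\<close>

lemma corner_balance_edge:
  "of_bool (addable R M (0, 0)) = (1 - of_bool ((0, 0) \<in> M) :: real)"
  "Suc p < a \<Longrightarrow> of_bool (addable R M (Suc p, 0)) =
     (of_bool ((p, 0) \<in> M) - of_bool ((Suc p, 0) \<in> M) :: real)"
  "Suc q < b \<Longrightarrow> of_bool (addable R M (0, Suc q)) =
     (of_bool ((0, q) \<in> M) - of_bool ((0, Suc q) \<in> M) :: real)"
  using pos down[of "Suc p" 0 p 0] down[of 0 "Suc q" 0 q] by (auto simp: addable_iff)

end

lemma rectangle_ideal_below:
  assumes "a > 0" "b > 0" "f \<in> gap_fillings ({..<a} \<times> {..<b})"
  shows "rectangle_ideal a b (below ({..<a} \<times> {..<b}) f)"
proof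
  let ?S = "{..<a} \<times> {..<b}"
  have le: "fst f x \<le> fst f y" if "x \<in> ?S" "y \<in> ?S" "before x y \<or> x = y" for x y
    using gap_increasing[OF assms(3) that(1,2)] that(3) by auto
  fix i j i' j' assume ij: "(i, j) \<in> below ?S f" "i' \<le> i" "j' \<le> j"
  \<comment> \<open>Only boxes of one row or column are compared directly, hence the detour through
    \<open>(i, j')\<close>.\<close>
  have "fst f (i', j') \<le> fst f (i, j')" using ij by (intro le) (auto simp: before_def)
  also have "\<dots> \<le> fst f (i, j)" using ij by (intro le) (auto simp: before_def)
  finally show "(i', j') \<in> below ?S f" using ij by auto
qed (use assms in auto)

text \<open>Adding up the corner relations of the ideals of all gap fillings gives the hypotheses of
  \<open>sum_of_corner_balance\<close>.\<close>

lemma sum_card_addable_rectangle: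
  fixes a b :: nat
  assumes pos: "a > 0" "b > 0"
  defines "S \<equiv> {..<a} \<times> {..<b}"
  shows "(real a + real b) *
      (\<Sum>x\<in>S. real (card {f \<in> gap_fillings S. addable S (below S f) x})) =
    real a * real b * real (card (gap_fillings S))"
proof -
  let ?G = "gap_fillings S"
  have fin: "finite ?G" by (rule finite_gap_fillings) (simp add: S_def)
  have ideal: "rectangle_ideal a b (below S f)" if "f \<in> ?G" for f
    using rectangle_ideal_below[OF pos, of f] that by (simp add: S_def)
  have count: "real (card {f \<in> ?G. P f}) = (\<Sum>f\<in>?G. of_bool (P f))" for P
    using fin by (simp add: of_bool_def sum.If_cases Int_def)
  define A where "A = (\<lambda>p q. real (card {f \<in> ?G. addable S (below S f) (p, q)}))"
  define X where "X = (\<lambda>p q. real (card {f \<in> ?G. (p, q) \<in> below S f}))"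
  have A: "A p q = (\<Sum>f\<in>?G. of_bool (addable S (below S f) (p, q)))" for p q
    unfolding A_def by (rule count)
  \<comment> \<open>The swap symmetry enters here: the same \<open>A\<close> also counts
    removability, so the summed relations involve one function in place of two.\<close>
  have A': "A p q = (\<Sum>f\<in>?G. of_bool (removable S (below S f) (p, q)))" for p q
    unfolding A_def card_addable_eq_removable by (rule count)
  have X: "X p q = (\<Sum>f\<in>?G. of_bool ((p, q) \<in> below S f))" for p q
    unfolding X_def by (rule count)
  have "(real a + real b) * (\<Sum>p<a. \<Sum>q<b. A p q) = real a * real b * real (card ?G)"
  proof (rule sum_of_corner_balance[OF _ _ _ _ _ pos, of A X])
    show "A (Suc p) (Suc q) - A p q = X p (Suc q) + X (Suc p) q - X p q - X (Suc p) (Suc q)" for p q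
      unfolding A[of "Suc p" "Suc q"] A'[of p q] X sum_subtractf[symmetric] sum.distrib[symmetric]
      by (intro sum.cong refl) (use rectangle_ideal.corner_balance[OF ideal] in \<open>simp add: S_def\<close>)
    show "A (Suc p) 0 = X p 0 - X (Suc p) 0" if "Suc p < a" for p
      unfolding A X sum_subtractf[symmetric]
      by (intro sum.cong refl) (use rectangle_ideal.corner_balance_edge(2)[OF ideal that] in \<open>simp add: S_def\<close>)
    show "A 0 (Suc q) = X 0 q - X 0 (Suc q)" if "Suc q < b" for q
      unfolding A X sum_subtractf[symmetric]
      by (intro sum.cong refl) (use rectangle_ideal.corner_balance_edge(3)[OF ideal that] in \<open>simp add: S_def\<close>)
    have "A 0 0 = (\<Sum>f\<in>?G. 1 - of_bool ((0, 0) \<in> below S f))"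
      unfolding A
      by (intro sum.cong refl) (use rectangle_ideal.corner_balance_edge(1)[OF ideal] in \<open>simp add: S_def\<close>)
    then show "A 0 0 = real (card ?G) - X 0 0" by (simp add: X sum_subtractf)
    show "A p q = 0 \<and> X p q = 0" if "a \<le> p \<or> b \<le> q" for p q
      using that by (auto simp: A_def X_def S_def addable_def)
  qed
  also have "(\<Sum>p<a. \<Sum>q<b. A p q) = (\<Sum>x\<in>S. case x of (p, q) \<Rightarrow> A p q)"
    unfolding S_def by (rule sum.cartesian_product)
  finally show ?thesis by (simp add: A_def case_prod_unfold)
qed

section \<open>Staircase paths\<close>

context
  fixes l :: "nat list" and p :: "(nat \<times> nat) list"
  assumes path: "staircase_path l p"
begin

lemma staircase_path_step:
  assumes "Suc k < length p"
  shows "right_step (p ! k) (p ! Suc k) \<or> up_step (p ! k) (p ! Suc k)"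
  using path assms by (auto simp: staircase_path_def)

lemma staircase_path_first: "p ! 0 = (length l, 0)" and staircase_path_nonempty: "0 < length p"
  using path by (auto simp: staircase_path_def hd_conv_nth)

lemma staircase_path_last: "p ! (length p - Suc 0) = (0, hd l)"
  using path by (auto simp: staircase_path_def last_conv_nth)

text \<open>Either kind of step raises column minus row by one, so the index of a point is the
  number of its diagonal. The equation is written additively to stay within the natural
  numbers.\<close>

lemma staircase_path_content: "k < length p \<Longrightarrow> snd (p ! k) + length l = fst (p ! k) + k"
proof (induction k)
  case 0
  then show ?case by (simp add: staircase_path_first)
next
  case (Suc k)
  then show ?case using staircase_path_step[of k] by (auto simp: right_step_def up_step_def)
qed

lemma length_staircase_path: "length p = length l + hd l + 1"
proof -
  have "length p - 1 < length p" using staircase_path_nonempty by simp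
  from staircase_path_content[OF this] this show ?thesis
    by (simp add: staircase_path_last)
qed

lemma staircase_path_mono:
  assumes "k \<le> k'" "k' < length p"
  shows "fst (p ! k') \<le> fst (p ! k)" "snd (p ! k) \<le> snd (p ! k')"
proof -
  have "fst (p ! k') \<le> fst (p ! k) \<and> snd (p ! k) \<le> snd (p ! k')"
    using assms
  proof (induction rule: dec_induct)
    case (step n)
    then show ?case using staircase_path_step[of n] by (auto simp: right_step_def up_step_def)
  qed simp
  then show "fst (p ! k') \<le> fst (p ! k)" "snd (p ! k) \<le> snd (p ! k')" by auto
qed

lemma staircase_path_bounds:
  assumes "k < length p"
  shows "fst (p ! k) \<le> length l" "snd (p ! k) \<le> hd l"
proof -
  have "k \<le> length p - 1" "length p - 1 < length p" using assms by auto
  then show "fst (p ! k) \<le> length l" "snd (p ! k) \<le> hd l"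
    using staircase_path_mono(1)[of 0 k] staircase_path_mono(2)[of k "length p - 1"] assms
    by (simp_all add: staircase_path_first staircase_path_last)
qed

text \<open>The row coordinate drops by at most one per step, so the first point with row coordinate
  at most \<open>i\<close> is entered by an up-step from \<open>Suc i\<close>.\<close>

lemma staircase_path_climb:
  assumes "i < length l"
  shows "\<exists>k c. Suc k < length p \<and> p ! k = (Suc i, c) \<and> p ! Suc k = (i, c)"
proof -
  define n where "n = (LEAST n. n < length p \<and> fst (p ! n) \<le> i)"
  have n: "n < length p \<and> fst (p ! n) \<le> i"
    unfolding n_def
    by (rule LeastI[of _ "length p - 1"]) (use staircase_path_nonempty in \<open>simp add: staircase_path_last\<close>)
  then have "n \<noteq> 0" using assms by (auto simp: staircase_path_first intro: ccontr)
  then obtain k where k: "n = Suc k" by (cases n) auto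
  then have "fst (p ! k) > i" using not_less_Least[of k "\<lambda>n. n < length p \<and> fst (p ! n) \<le> i"] n
    by (simp add: n_def[symmetric])
  then have "p ! k = (Suc i, snd (p ! k))" "p ! Suc k = (i, snd (p ! k))"
    using staircase_path_step[of k] n k by (auto simp: right_step_def up_step_def prod_eq_iff)
  then show ?thesis using n k by blast
qed

end

section \<open>The boundary of an ideal as the unique dividing path\<close>

lemma box_sides_intros:
  "{(i, j), (i, Suc j)} \<in> box_sides (i, j)"
  "{(Suc i, j), (Suc i, Suc j)} \<in> box_sides (i, j)"
  "{(Suc i, j), (i, j)} \<in> box_sides (i, j)"
  "{(Suc i, Suc j), (i, Suc j)} \<in> box_sides (i, j)"
  by (simp_all add: box_sides_def insert_commute)

context rectangle_ideal
begin

abbreviation L :: "nat list" where "L \<equiv> replicate a b"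

(* On each diagonal exactly one lattice point satisfies this; these points form the path. *)
definition boundary :: "nat \<times> nat \<Rightarrow> bool" where
  "boundary x \<longleftrightarrow> x \<notin> M \<and> (fst x = 0 \<or> snd x = 0 \<or> (fst x - 1, snd x - 1) \<in> M)"

text \<open>A lattice point is identified with the box of which it is the upper left corner. If
  \<open>y\<close> lies further down the diagonal of \<open>x\<close>, then the box diagonally
  before \<open>y\<close> is in \<open>M\<close>, and down-closure would put \<open>x\<close> into
  \<open>M\<close>.\<close>

lemma boundary_unique_aux:
  assumes "boundary x" "boundary y" "snd x + a = fst x + k" "snd y + a = fst y + k"
  shows "\<not> fst x < fst y"
proof
  assume "fst x < fst y"
  then have "fst x \<le> fst y - 1" "snd x \<le> snd y - 1" "(fst y - 1, snd y - 1) \<in> M"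
    using assms by (auto simp: boundary_def)
  then have "(fst x, snd x) \<in> M" using down by blast
  then show False using assms(1) by (simp add: boundary_def)
qed

lemma boundary_unique:
  assumes "boundary x" "boundary y" "snd x + a = fst x + k" "snd y + a = fst y + k"
  shows "x = y"
  using boundary_unique_aux[OF assms] boundary_unique_aux[OF assms(2,1,4,3)] assms(3,4)
  by (simp add: prod_eq_iff)

lemma boundary_bounds:
  assumes "boundary x" "snd x + a = fst x + k" "k \<le> a + b"
  shows "fst x \<le> a" "snd x \<le> b"
proof -
  have "fst x - 1 < a \<and> snd x - 1 < b" if "(fst x - 1, snd x - 1) \<in> M" using that sub by auto
  then show "fst x \<le> a" "snd x \<le> b" using assms by (auto simp: boundary_def)
qed

text \<open>The box \<open>(r - 1, c)\<close> to the upper right of the point decides. If it is in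
  \<open>M\<close>, or the top edge is reached, the path goes right underneath it; otherwise it goes
  up.\<close>

lemma boundary_next:
  assumes "boundary x" "snd x + a = fst x + k" "k < a + b"
  shows "\<exists>y. boundary y \<and> snd y + a = fst y + Suc k \<and> (right_step x y \<or> up_step x y)"
proof -
  obtain r c where x: "x = (r, c)" by force
  have out: "(r, c) \<notin> M" and corner: "r = 0 \<or> c = 0 \<or> (r - 1, c - 1) \<in> M"
    using assms by (auto simp: x boundary_def)
  have out': "(r, Suc c) \<notin> M" using out down[of r "Suc c" r c] by auto
  show ?thesis
  proof (cases "r = 0 \<or> (r - 1, c) \<in> M")
    case True
    then have "boundary (r, Suc c)" using out' by (auto simp: boundary_def)
    then show ?thesis using assms(2)
      by (intro exI[of _ "(r, Suc c)"]) (simp add: x right_step_def)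
  next
    case False
    have "(r - 1 - 1, c - 1) \<in> M" if "c \<noteq> 0"
      using corner False that down[of "r - 1" "c - 1" "r - 1 - 1" "c - 1"] by auto
    then have "boundary (r - 1, c)" using False by (auto simp: boundary_def)
    then show ?thesis using assms(2) False
      by (intro exI[of _ "(r - 1, c)"]) (simp add: x up_step_def)
  qed
qed

definition boundary_path :: "(nat \<times> nat) list \<Rightarrow> bool" where
  "boundary_path p \<longleftrightarrow> length p = a + b + 1 \<and>
     (\<forall>k \<le> a + b. boundary (p ! k) \<and> snd (p ! k) + a = fst (p ! k) + k)"

lemma boundary_path_unique:
  assumes "boundary_path p" "boundary_path q"
  shows "p = q"
proof (rule nth_equalityI)
  fix k assume "k < length p"
  then show "p ! k = q ! k"
    using assms boundary_unique[of "p ! k" "q ! k" k] by (simp add: boundary_path_def)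
qed (use assms in \<open>simp add: boundary_path_def\<close>)

lemma boundary_path_exists: "\<exists>p. boundary_path p"
proof -
  have ex: "\<exists>x. boundary x \<and> snd x + a = fst x + k" if "k \<le> a + b" for k
    using that
  proof (induction k)
    case 0
    have "boundary (a, 0)" using sub by (auto simp: boundary_def)
    then show ?case by (intro exI[of _ "(a, 0)"]) simp
  next
    case (Suc k)
    then obtain x where "boundary x" "snd x + a = fst x + k" by auto
    then show ?case using boundary_next[of x k] Suc.prems by auto
  qed
  define pt where "pt = (\<lambda>k. SOME x. boundary x \<and> snd x + a = fst x + k)"
  have pt: "boundary (pt k) \<and> snd (pt k) + a = fst (pt k) + k" if "k \<le> a + b" for k
    unfolding pt_def using ex[OF that] by (rule someI_ex)
  have "boundary_path (map pt [0..<a + b + 1])"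
    using pt by (simp add: boundary_path_def del: upt_Suc)
  then show ?thesis ..
qed

lemma boundary_path_nth:
  assumes "boundary_path p" "boundary x" "snd x + a = fst x + k" "k \<le> a + b"
  shows "p ! k = x"
  using assms boundary_unique[of "p ! k" x k] by (simp add: boundary_path_def)

lemma boundary_path_staircase:
  assumes p: "boundary_path p"
  shows "staircase_path L p"
proof -
  have len: "length p = a + b + 1" and bd: "\<And>k. k \<le> a + b \<Longrightarrow> boundary (p ! k)"
    and cont: "\<And>k. k \<le> a + b \<Longrightarrow> snd (p ! k) + a = fst (p ! k) + k"
    using p by (auto simp: boundary_path_def)
  have bounds: "fst (p ! k) \<le> a \<and> snd (p ! k) \<le> b" if "k \<le> a + b" for k
    using boundary_bounds[OF bd cont that] that by blast
  have "p \<noteq> []" using len by auto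
  have "p ! 0 = (a, 0)" using bounds[of 0] cont[of 0] by (simp add: prod_eq_iff)
  then have hd: "hd p = (length L, 0)" using \<open>p \<noteq> []\<close> by (simp add: hd_conv_nth)
  have "p ! (a + b) = (0, b)" using bounds[of "a + b"] cont[of "a + b"] by (simp add: prod_eq_iff)
  then have last: "last p = (0, hd L)" using \<open>p \<noteq> []\<close> len pos by (simp add: last_conv_nth)
  have "(right_step (p ! k) (p ! (k + 1)) \<or> up_step (p ! k) (p ! (k + 1))) \<and>
      (\<exists>x\<in>boxes L. {p ! k, p ! (k + 1)} \<in> box_sides x)" if "k + 1 < length p" for k
  proof -
    have k: "k < a + b" using that len by simp
    obtain y where y: "boundary y" "snd y + a = fst y + Suc k" "right_step (p ! k) y \<or> up_step (p ! k) y"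
      using boundary_next[of "p ! k" k] bd[of k] cont[of k] k by auto
    have py: "p ! Suc k = y" using boundary_path_nth[OF p y(1,2)] k by simp
    obtain r c where rc: "p ! k = (r, c)" by force
    have le: "r \<le> a" "c \<le> b" "fst y \<le> a" "snd y \<le> b"
      using bounds[of k] bounds[of "Suc k"] k py by (auto simp: rc)
    have "\<exists>x\<in>boxes L. {p ! k, p ! (k + 1)} \<in> box_sides x"
    proof (cases "right_step (p ! k) y")
      case True
      then have yv: "y = (r, Suc c)" by (simp add: right_step_def rc prod_eq_iff)
      then have c: "c < b" using le by simp
      \<comment> \<open>A right-step is the top side of \<open>(r, c)\<close>, except on the bottom
        rim, where it borders only the box above. Up-steps on the right rim are treated in the same
        way below.\<close>
      show ?thesis
      proof (cases "r < a")
        case True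
        then show ?thesis using c box_sides_intros(1)[of r c]
          by (intro bexI[of _ "(r, c)"]) (simp_all add: py rc yv boxes_replicate)
      next
        case False
        then have "r = Suc (a - 1)" "a - 1 < a" using le pos by auto
        then show ?thesis using c box_sides_intros(2)[of "a - 1" c]
          by (intro bexI[of _ "(a - 1, c)"]) (simp_all add: py rc yv boxes_replicate)
      qed
    next
      case False
      define i where "i = fst y"
      have yv: "r = Suc i" "y = (i, c)" using False y(3) by (auto simp: up_step_def rc i_def prod_eq_iff)
      then have i: "i < a" using le by simp
      show ?thesis
      proof (cases "c < b")
        case True
        then show ?thesis using i box_sides_intros(3)[of i c]
          by (intro bexI[of _ "(i, c)"]) (simp_all add: py rc yv boxes_replicate)
      next
        case False
        then have "c = Suc (b - 1)" "b - 1 < b" using le pos by auto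
        then show ?thesis using i box_sides_intros(4)[of i "b - 1"]
          by (intro bexI[of _ "(i, b - 1)"]) (simp_all add: py rc yv boxes_replicate)
      qed
    qed
    then show ?thesis using y(3) by (simp add: py)
  qed
  then show ?thesis using \<open>p \<noteq> []\<close> hd last by (simp add: staircase_path_def)
qed

text \<open>Let the path climb through row \<open>i\<close> at column \<open>c\<close>. The upper
  end of the step keeps \<open>(i, c)\<close> out of \<open>M\<close>, and for \<open>c > 0\<close>
  the lower end puts \<open>(i, c - 1)\<close> into \<open>M\<close>.\<close>

lemma boundary_path_divides:
  assumes p: "boundary_path p" and x: "x \<in> R"
  shows "x \<in> M \<longleftrightarrow> upper_left p x"
proof
  obtain i j where ij: "x = (i, j)" by force
  have bd: "\<And>k. k < length p \<Longrightarrow> boundary (p ! k)" using p by (auto simp: boundary_path_def)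
  {
    assume "x \<in> M"
    obtain k c where k: "Suc k < length p" "p ! k = (Suc i, c)" "p ! Suc k = (i, c)"
      using staircase_path_climb[OF boundary_path_staircase[OF p], of i] x ij by auto
    then have "(i, c) \<notin> M" using bd[of "Suc k"] by (simp add: boundary_def)
    then have "j < c" using \<open>x \<in> M\<close> down[of i j i c] ij by (auto simp: not_less[symmetric])
    then show "upper_left p x" using k by (auto simp: upper_left_def ij)
  }
  {
    assume "upper_left p x"
    then obtain k c where k: "k + 1 < length p" "p ! k = (i + 1, c)" "j < c"
      by (auto simp: upper_left_def ij)
    then have "(i, c - 1) \<in> M" using bd[of k] by (auto simp: boundary_def)
    then show "x \<in> M" using k down[of i "c - 1" i j] by (auto simp: ij)
  }
qed

text \<open>This gives the uniqueness behind the \<open>THE\<close> in \<open>dividing_path\<close>: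
  a dividing path consists of boundary points, and each diagonal has only one.\<close>

lemma boundary_pathI:
  assumes p: "staircase_path L p" and div: "\<And>x. x \<in> R \<Longrightarrow> x \<in> M \<longleftrightarrow> upper_left p x"
  shows "boundary_path p"
proof -
  note mono = staircase_path_mono[OF p]
  have len: "length p = a + b + 1" using length_staircase_path[OF p] pos by simp
  have "boundary (p ! k)" if k: "k < length p" for k
  proof -
    obtain r c where rc: "p ! k = (r, c)" by force
    have le: "r \<le> a" "c \<le> b" using staircase_path_bounds[OF p k] pos by (simp_all add: rc)
    have "(r, c) \<notin> M"
    proof
      assume "(r, c) \<in> M"
      then have "upper_left p (r, c)" using div sub by blast
      then obtain k' c' where k': "k' + 1 < length p" "p ! k' = (r + 1, c')" "p ! (k' + 1) = (r, c')" "c < c'"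
        by (auto simp: upper_left_def)
      \<comment> \<open>Row coordinates never increase along the path, so the climb through row
        \<open>r\<close> precedes the point \<open>(r, c)\<close> and happens at a column at most
        \<open>c\<close>.\<close>
      have "k' < k" using mono(1)[of k k'] k' rc by (cases "k' < k") auto
      then have "c' \<le> c" using mono(2)[of "k' + 1" k] k k' rc by simp
      then show False using k' by simp
    qed
    moreover have "(r - 1, c - 1) \<in> M" if nz: "r \<noteq> 0" "c \<noteq> 0"
    proof -
      have "r - 1 < length L" using le nz by simp
      then obtain k' c' where k': "Suc k' < length p" "p ! k' = (Suc (r - 1), c')" "p ! Suc k' = (r - 1, c')"
        using staircase_path_climb[OF p] by blast
      have "k \<le> k'" using mono(1)[of "Suc k'" k] k k' rc nz by (cases "k \<le> k'") auto
      then have "c \<le> c'" using mono(2)[of k k'] k' rc by simp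
      then have "upper_left p (r - 1, c - 1)"
        using k' nz unfolding upper_left_def by (intro exI[of _ k'] exI[of _ c']) auto
      moreover have "r - 1 < a" "c - 1 < b" using le nz by linarith+
      then have "(r - 1, c - 1) \<in> R" by simp
      ultimately show ?thesis using div by blast
    qed
    ultimately show ?thesis by (auto simp: boundary_def rc)
  qed
  moreover have "snd (p ! k) + a = fst (p ! k) + k" if "k < length p" for k
    using staircase_path_content[OF p that] by simp
  ultimately show ?thesis by (simp add: boundary_path_def len)
qed

lemma boundary_path_dividing_path:
  assumes "\<And>x. x \<in> R \<Longrightarrow> T x < m \<longleftrightarrow> x \<in> M"
  shows "boundary_path (dividing_path L T m)"
proof -
  obtain p where p: "boundary_path p" using boundary_path_exists by blast
  have "dividing_path L T m = p"
    unfolding dividing_path_def boxes_replicate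
  proof (rule the_equality)
    show "staircase_path L p \<and> (\<forall>x\<in>R. (T x < m) = upper_left p x)"
      using boundary_path_staircase[OF p] boundary_path_divides[OF p] assms by simp
    fix q assume "staircase_path L q \<and> (\<forall>x\<in>R. (T x < m) = upper_left q x)"
    then have "boundary_path q" using assms by (intro boundary_pathI) auto
    then show "q = p" using p by (rule boundary_path_unique)
  qed
  then show ?thesis using p by simp
qed

section \<open>Turns of the path and corners of the ideal\<close>

lemma corner_turn:
  assumes p: "boundary_path p" and x: "addable R M (i, j) \<or> removable R M (i, j)"
  shows "is_turn L p (j + a - i - 1)"
proof -
  \<comment> \<open>The turn starts at the lower left corner \<open>(Suc i, j)\<close> of the box,
    and this is the index of its diagonal.\<close>
  let ?k = "j + a - i - 1"
  have ij: "i < a" "j < b" using x by (auto simp: addable_def removable_def)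
  \<comment> \<open>Both kinds of corner share the end points of the turn. They differ in the middle
    point: the upper left corner of an addable box, the lower right corner of a removable
    one.\<close>
  have nbs: "boundary (Suc i, j) \<and> boundary (i, Suc j)"
    using x down[of "Suc i" j i j] down[of i "Suc j" i j] down[of i j i "j - 1"] down[of i j "i - 1" j]
    unfolding addable_iff removable_iff boundary_def by auto
  have p0: "p ! ?k = (Suc i, j)" and p2: "p ! (?k + 2) = (i, Suc j)"
    using boundary_path_nth[OF p, of "(Suc i, j)" ?k] boundary_path_nth[OF p, of "(i, Suc j)" "?k + 2"]
      nbs ij by auto
  have box: "(i, j) \<in> boxes L" using ij by (simp add: boxes_replicate)
  have len: "?k + 2 < length p" using p ij by (simp add: boundary_path_def)
  note sides = box_sides_intros[of i j]
  from x show ?thesis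
  proof
    assume "addable R M (i, j)"
    then have "boundary (i, j)"
      using down[of "i - 1" j "i - 1" "j - 1"] unfolding addable_iff boundary_def by auto
    then have p1: "p ! (?k + 1) = (i, j)"
      using boundary_path_nth[OF p, of "(i, j)" "?k + 1"] ij by auto
    have "up_step (Suc i, j) (i, j)" "right_step (i, j) (i, Suc j)"
      by (simp_all add: up_step_def right_step_def)
    then show ?thesis unfolding is_turn_def p0 p1 p2 using len box sides by blast
  next
    assume "removable R M (i, j)"
    then have "boundary (Suc i, Suc j)"
      using down[of "Suc i" "Suc j" "Suc i" j] unfolding removable_iff boundary_def by auto
    then have p1: "p ! (?k + 1) = (Suc i, Suc j)"
      using boundary_path_nth[OF p, of "(Suc i, Suc j)" "?k + 1"] ij by auto
    have "right_step (Suc i, j) (Suc i, Suc j)" "up_step (Suc i, Suc j) (i, Suc j)"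
      by (simp_all add: up_step_def right_step_def)
    then show ?thesis unfolding is_turn_def p0 p1 p2 using len box sides by blast
  qed
qed

text \<open>The middle point \<open>(r, c)\<close> determines the box. Right then up encloses the
  removable box \<open>(r - 1, c - 1)\<close>, up then right the addable box
  \<open>(r, c)\<close>.\<close>

lemma turn_corner:
  assumes p: "boundary_path p" and t: "is_turn L p k"
  shows "\<exists>i j. (addable R M (i, j) \<or> removable R M (i, j)) \<and> k = j + a - i - 1"
proof -
  have k: "k + 2 \<le> a + b" using t p by (simp add: is_turn_def boundary_path_def)
  have bd: "boundary (p ! n)" and cont: "snd (p ! n) + a = fst (p ! n) + n" if "n \<le> a + b" for n
    using p that by (auto simp: boundary_path_def)
  have bounds: "fst (p ! n) \<le> a \<and> snd (p ! n) \<le> b" if "n \<le> a + b" for n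
    using boundary_bounds[OF bd cont that] that by blast
  obtain r c where rc: "p ! (k + 1) = (r, c)" by force
  note facts = bd[of k] bd[of "k + 1"] bd[of "k + 2"] cont[of "k + 1"] bounds[of k] bounds[of "k + 2"] k
  from t consider "right_step (p ! k) (r, c)" "up_step (r, c) (p ! (k + 2))"
    | "up_step (p ! k) (r, c)" "right_step (r, c) (p ! (k + 2))"
    unfolding is_turn_def rc by blast
  then show ?thesis
  proof cases
    case 1
    have c: "c > 0" and p0: "p ! k = (r, c - 1)" using 1(1) by (auto simp: right_step_def prod_eq_iff)
    have r: "r > 0" and p2: "p ! (k + 2) = (r - 1, c)" using 1(2) by (auto simp: up_step_def prod_eq_iff)
    have "removable R M (r - 1, c - 1)"
      using facts rc c r unfolding removable_iff p0 p2 boundary_def by auto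
    moreover have "k = (c - 1) + a - (r - 1) - 1"
      using facts rc c r by auto
    ultimately show ?thesis by blast
  next
    case 2
    have p0: "p ! k = (Suc r, c)" using 2(1) by (auto simp: up_step_def prod_eq_iff)
    have p2: "p ! (k + 2) = (r, Suc c)" using 2(2) by (auto simp: right_step_def prod_eq_iff)
    have "addable R M (r, c)"
      using facts rc unfolding addable_iff p0 p2 boundary_def by auto
    moreover have "k = c + a - r - 1"
      using facts rc by auto
    ultimately show ?thesis by blast
  qed
qed

text \<open>A corner further down the same diagonal forces the box \<open>(Suc i, j)\<close> into
  \<open>M\<close>. Then \<open>(i, j)\<close> is in \<open>M\<close> but not removable.\<close>

lemma corner_content_unique_aux:
  assumes "addable R M (i, j) \<or> removable R M (i, j)"
    and "addable R M (i', j') \<or> removable R M (i', j')"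
    and "j + i' = j' + i"
  shows "\<not> i < i'"
proof
  assume "i < i'"
  then have "(Suc i, j) \<in> M"
    using assms(2,3) down[of i' j' "Suc i" j] down[of i' "j' - 1" "Suc i" j]
    by (auto simp: addable_iff removable_iff)
  then show False using assms(1) down[of "Suc i" j i j] by (auto simp: addable_iff removable_iff)
qed

lemma card_turns:
  assumes p: "boundary_path p"
  shows "turns L p = card {x. addable R M x} + card {x. removable R M x}"
proof -
  (* Turns and corners correspond by their diagonals. *)
  let ?C = "{x. addable R M x \<or> removable R M x}"
  let ?k = "\<lambda>(i, j). j + a - i - 1"
  have fin: "finite {x. addable R M x}" "finite {x. removable R M x}"
    by (rule finite_subset[of _ R]; auto simp: addable_def removable_def)+
  have "inj_on ?k ?C"
  proof (rule inj_onI)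
    fix x y assume xy: "x \<in> ?C" "y \<in> ?C" "?k x = ?k y"
    obtain i j where x: "x = (i, j)" by force
    obtain i' j' where y: "y = (i', j')" by force
    note ij = x y
    have "i < a" "i' < a" using xy by (auto simp: ij addable_def removable_def)
    then have eq: "j + i' = j' + i" using xy(3) by (simp add: ij)
    have "\<not> i < i'" using corner_content_unique_aux[of i j i' j'] xy eq by (simp add: ij)
    moreover have "\<not> i' < i" using corner_content_unique_aux[of i' j' i j] xy eq by (simp add: ij)
    ultimately show "x = y" using eq by (simp add: ij)
  qed
  moreover have "?k ` ?C = {k. is_turn L p k}"
  proof (intro equalityI subsetI)
    fix k assume "k \<in> ?k ` ?C"
    then obtain i j where "addable R M (i, j) \<or> removable R M (i, j)" "k = j + a - i - 1" by auto
    then show "k \<in> {k. is_turn L p k}" using corner_turn[OF p] by blast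
  next
    fix k assume "k \<in> {k. is_turn L p k}"
    then obtain i j where ij: "addable R M (i, j) \<or> removable R M (i, j)" "k = j + a - i - 1"
      using turn_corner[OF p] by blast
    then show "k \<in> ?k ` ?C" by (intro image_eqI[of _ _ "(i, j)"]) simp_all
  qed
  ultimately have "turns L p = card ?C" unfolding turns_def using card_image[of ?k ?C] by simp
  also have "?C = {x. addable R M x} \<union> {x. removable R M x}" by auto
  also have "card \<dots> = card {x. addable R M x} + card {x. removable R M x}"
    using fin by (intro card_Un_disjoint) (auto simp: addable_def removable_def)
  finally show ?thesis .
qed

lemma turns_dividing_path:
  assumes "\<And>x. x \<in> R \<Longrightarrow> T x < m \<longleftrightarrow> x \<in> M"
  shows "turns L (dividing_path L T m) =
    (\<Sum>x\<in>R. of_bool (addable R M x)) + (\<Sum>x\<in>R. of_bool (removable R M x))"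
proof -
  have "{x. addable R M x} = {x \<in> R. addable R M x}" "{x. removable R M x} = {x \<in> R. removable R M x}"
    by (auto simp: addable_def removable_def)
  then show ?thesis
    using card_turns[OF boundary_path_dividing_path[OF assms]]
    by (simp add: of_bool_def sum.If_cases Int_def)
qed

end

section \<open>Expected number of turns\<close>

lemma expectation_pair_pmf_of_set:
  fixes f :: "'a \<times> 'b \<Rightarrow> real"
  assumes "finite A" "A \<noteq> {}" "finite B" "B \<noteq> {}"
  shows "measure_pmf.expectation (pair_pmf (pmf_of_set A) (pmf_of_set B)) f =
    (\<Sum>x\<in>A \<times> B. f x) / (real (card A) * real (card B))"
proof -
  have "pair_pmf (pmf_of_set A) (pmf_of_set B) = pmf_of_set (A \<times> B)"
  proof (rule pmf_eqI, clarify)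
    fix x y
    have "pmf (pmf_of_set (A \<times> B)) (x, y) = indicator (A \<times> B) (x, y) / card (A \<times> B)"
      using assms by (intro pmf_of_set) auto
    then show "pmf (pair_pmf (pmf_of_set A) (pmf_of_set B)) (x, y) = pmf (pmf_of_set (A \<times> B)) (x, y)"
      unfolding pmf_pair pmf_of_set[OF assms(2,1)] pmf_of_set[OF assms(4,3)]
      by (simp add: card_cartesian_product indicator_def)
  qed
  then show ?thesis
    using assms by (simp add: integral_pmf_of_set card_cartesian_product)
qed

text \<open>Turns are addable plus removable boxes. Reindexing by \<open>insert_gap\<close> turns
  the sum into one over gap fillings, where both kinds contribute the number of edges.\<close>

lemma sum_turns_rectangle:
  fixes a b :: nat
  assumes pos: "a > 0" "b > 0"
  defines "l \<equiv> replicate a b"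
  shows "(\<Sum>(T, m)\<in>SYT l \<times> {1..size_of l + 1}. real (turns l (dividing_path l T m))) =
    2 * real (card (BN_edges l))"
proof -
  define S where "S = boxes l"
  have SR: "S = {..<a} \<times> {..<b}" by (simp add: S_def l_def boxes_replicate)
  let ?G = "gap_fillings S"
  have finS: "finite S" by (simp add: SR)
  have finG: "finite ?G" using finS by (rule finite_gap_fillings)
  let ?add = "\<lambda>f x. addable S (below S f) x" and ?rem = "\<lambda>f x. removable S (below S f) x"
  have count: "(\<Sum>f\<in>?G. of_bool (P f)) = card {f \<in> ?G. P f}" for P
    using finG by (simp add: of_bool_def sum.If_cases Int_def)
  have "(\<Sum>p\<in>SYT l \<times> {1..size_of l + 1}. turns l (dividing_path l (fst p) (snd p))) =
    (\<Sum>p\<in>linear_extensions S \<times> {1..card S + 1}.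
      (\<Sum>x\<in>S. of_bool (?add (insert_gap S p) x)) + (\<Sum>x\<in>S. of_bool (?rem (insert_gap S p) x)))"
  proof (rule sum.cong)
    show "SYT l \<times> {1..size_of l + 1} = linear_extensions S \<times> {1..card S + 1}"
      by (simp add: SYT_eq S_def)
    fix p assume p: "p \<in> linear_extensions S \<times> {1..card S + 1}"
    obtain T m where Tm: "p = (T, m)" by force
    have "insert_gap S p \<in> ?G" using bij_betw_apply[OF bij_betw_insert_gap[OF finS] p] .
    then interpret rectangle_ideal a b "below S (insert_gap S p)"
      using rectangle_ideal_below[OF pos, of "insert_gap S p"] by (simp add: SR)
    have "T x < m \<longleftrightarrow> x \<in> below S (insert_gap S p)" if "x \<in> {..<a} \<times> {..<b}" for x
      using that unfolding Tm below_insert_gap SR by simp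
    from turns_dividing_path[OF this]
    show "turns l (dividing_path l (fst p) (snd p)) =
      (\<Sum>x\<in>S. of_bool (?add (insert_gap S p) x)) + (\<Sum>x\<in>S. of_bool (?rem (insert_gap S p) x))"
      by (simp add: Tm l_def SR)
  qed
  also have "\<dots> = (\<Sum>f\<in>?G. (\<Sum>x\<in>S. of_bool (?add f x)) + (\<Sum>x\<in>S. of_bool (?rem f x)))"
    by (rule sum.reindex_bij_betw[OF bij_betw_insert_gap[OF finS]])
  also have "\<dots> = (\<Sum>x\<in>S. \<Sum>f\<in>?G. of_bool (?add f x)) + (\<Sum>x\<in>S. \<Sum>f\<in>?G. of_bool (?rem f x))"
    unfolding sum.distrib by (intro arg_cong2[of _ _ _ _ "(+)"] sum.swap)
  also have "\<dots> = 2 * card (BN_edges l)"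
    unfolding count card_addable_eq_removable[symmetric] card_BN_edges S_def[symmetric] by simp
  finally show ?thesis
    by (simp add: case_prod_unfold flip: of_nat_sum)
qed

theorem corollary2p16:
  fixes a b :: nat
  assumes "a > 0" and "b > 0"
  shows "expected_turns (replicate a b) = 2 * real a * real b / (real a + real b) \<and>
         real (card (BN_edges (replicate a b))) =
           real a * real b / (real a + real b) * fact (a * b + 1) *
           (\<Prod>j<b. fact j / fact (a + j))"
proof -
  let ?l = "replicate a b"
  let ?f = "real (card (SYT ?l))" and ?e = "real (card (BN_edges ?l))"
  let ?n = "real (a * b + 1)"
  have size: "size_of ?l = a * b" by (simp add: boxes_replicate)
  have fin: "finite (SYT ?l)" unfolding SYT_eq by (intro finite_linear_extensions finite_boxes)
  have f_eq: "?f = fact (a * b) * (\<Prod>j<b. fact j / fact (a + j))"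
    by (rule card_SYT_rectangle)
  \<comment> \<open>The product formula also shows that standard tableaux exist, as the uniform
    distribution on them requires.\<close>
  then have f_pos: "?f > 0" by (auto intro!: mult_pos_pos prod_pos)
  then have ne: "SYT ?l \<noteq> {}" by auto
  \<comment> \<open>The number of pairs \<open>(T, m)\<close>, the denominator of the expectation,
    is the number of gap fillings.\<close>
  have "card (gap_fillings (boxes ?l)) = card (SYT ?l \<times> {1..size_of ?l + 1})"
    using bij_betw_same_card[OF bij_betw_insert_gap[OF finite_boxes, of ?l]] by (simp add: SYT_eq)
  then have gap: "real (card (gap_fillings (boxes ?l))) = ?f * ?n"
    by (simp add: card_cartesian_product size algebra_simps)
  have "(real a + real b) * ?e = real a * real b * (?f * ?n)"
    using sum_card_addable_rectangle[OF assms] unfolding gap[symmetric] card_BN_edges of_nat_sum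
    by (simp add: boxes_replicate)
  then have e: "?e = real a * real b / (real a + real b) * (?f * ?n)"
    using assms by (simp add: field_simps)
  have "expected_turns ?l = 2 * ?e / (?f * ?n)"
    unfolding expected_turns_def
    using expectation_pair_pmf_of_set[OF fin ne, of "{1..size_of ?l + 1}"] sum_turns_rectangle[OF assms]
    by (simp add: size)
  also have "\<dots> = 2 * real a * real b / (real a + real b)"
  proof -
    have "2 * ?e = 2 * real a * real b / (real a + real b) * (?f * ?n)" unfolding e by simp
    moreover have "?n > 0" by (simp only: of_nat_0_less_iff)
    then have "?f * ?n \<noteq> 0" using mult_pos_pos[OF f_pos] by (metis less_irrefl)
    ultimately show ?thesis using nonzero_mult_div_cancel_right[of "?f * ?n"] by presburger
  qed
  finally have "expected_turns ?l = 2 * real a * real b / (real a + real b)" .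
  \<comment> \<open>The factor \<open>?n\<close> for the choice of \<open>m\<close> raises
    \<open>fact (a * b)\<close> to \<open>fact (a * b + 1)\<close>.\<close>
  moreover have "?e = real a * real b / (real a + real b) * fact (a * b + 1) * (\<Prod>j<b. fact j / fact (a + j))"
    unfolding e f_eq by (simp add: algebra_simps)
  ultimately show ?thesis by blast
qed

end
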